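(* Let $M_G$ be a mixed graph with vertex set $V$ and edge set $E$, and let $V_1\subseteq V$ be nonempty. Then \[\det(L[V_1])=\sum_{M_R}3^{\gamma_1}4^{\gamma_2},\] where the sum runs over all substructures $M_R$ with vertex set $V_1$ (i.e. over all edge subsets $E_1\subseteq E$ with $|E_1|=|V_1|$) that are substructures of type I, and $\gamma_1$, $\gamma_2$ are the numbers of components of $M_R$ that are unicyclic graphs belonging to $\Phi_2$ and to $\Phi_3$, respectively. Here $L[V_1]$ is the principal submatrix of $L(M_G)$ with rows and columns indexed by $V_1$.
   Context: All graphs are simple, finite and connected. A mixed graph $M_G$ is obtained from a graph $G$ (its underlying graph) by giving directions to some edges. Let $\omega=\frac{1+\sqrt{3}\mathbf{i}}{2}$. $N(M_G)=(n_{ij})$ has $n_{ij}=1$ if $v_i,v_j$ are joined by an undirected edge, $n_{ij}=\omega$ if there is an edge directed $v_i\to v_j$, $n_{ij}=\overline{\omega}$ if directed $v_j\to v_i$, and $0$ otherwise; $L(M_G)=D(M_G)-N(M_G)$ where $D(M_G)$ is the degree diagonal matrix of $G$. A substructure $M_R$ with vertex subset $V_1\subseteq V$ and edge subset $E_1\subseteq E$ consists of these vertices and edges (an edge of $E_1$ may have one or no endpoint in $V_1$); it is square if $|V_1|=|E_1|$. Its components are the connected pieces of the structure with vertices $V_1$ and edges $E_1$, where each edge of $E_1$ joins those of its endpoints lying in $V_1$ (an edge with no endpoint in $V_1$ is a component on its own). A component is a rootless tree if it is obtained from a tree by deleting one vertex (the root) while keeping the incident edge as an edge with only one endpoint; equivalently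 its edges with both endpoints in $V_1$ form a tree on its vertices and it contains exactly one edge of $E_1$ with exactly one endpoint in $V_1$. A component is a unicyclic graph if all its edges have both endpoints in $V_1$ and it is a connected graph with exactly one cycle. For a mixed cycle, fix a cyclic traversal direction; let $a$ (resp. $b$) be the number of directed edges oriented along (resp. against) the traversal. The cycle belongs to $\Phi_1$ if $a-b\equiv 1$ or $5\pmod 6$, to $\Phi_2$ if $a-b\equiv 2$ or $4\pmod 6$, to $\Phi_3$ if $a-b\equiv 3\pmod 6$, and to $\Phi_4$ if $a-b\equiv 0\pmod 6$; a unicyclic mixed graph belongs to the class of its cycle. A square substructure is of type I if each of its components is either a rootless tree or a unicyclic graph not belonging to $\Phi_4$. *)

theory Defs
  imports
    Complex_Main
    "Jordan_Normal_Form.Determinant"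
    "Jordan_Normal_Form.DL_Submatrix"
begin

definition connected_graph :: "'v set \<Rightarrow> 'v set set \<Rightarrow> bool" where
  "connected_graph W F \<longleftrightarrow>
     W \<noteq> {} \<and> (\<forall>u\<in>W. \<forall>v\<in>W. (u, v) \<in> {(x, y). {x, y} \<in> F}\<^sup>*)"

text \<open>A mixed graph is given by the vertices \<open>V\<close> and edges \<open>E\<close> (two-element sets) of its
  underlying graph and the set \<open>A\<close> of arcs: \<open>(u, v) \<in> A\<close> means that the edge \<open>{u, v}\<close> has been
  directed from \<open>u\<close> to \<open>v\<close>; an edge without an arc in either direction is undirected.\<close>

locale mixed_graph =
  fixes V :: "'v set" and E :: "'v set set" and A :: "('v \<times> 'v) set"
  assumes finite_V: "finite V"
    and simple: "e \<in> E \<Longrightarrow> e \<subseteq> V \<and> card e = 2"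
    and connected: "connected_graph V E"
    and arc_edge: "(u, v) \<in> A \<Longrightarrow> {u, v} \<in> E"
    and arc_asym: "(u, v) \<in> A \<Longrightarrow> (v, u) \<notin> A"

definition omega :: complex where
  "omega = (1 + complex_of_real (sqrt 3) * \<i>) / 2"

text \<open>The matrices are taken with respect to a listing \<open>vs\<close> of the vertices.\<close>

definition N_mat :: "'v list \<Rightarrow> 'v set set \<Rightarrow> ('v \<times> 'v) set \<Rightarrow> complex mat" where
  "N_mat vs E A = mat (length vs) (length vs) (\<lambda>(i, j).
     if {vs ! i, vs ! j} \<in> E then
       if (vs ! i, vs ! j) \<in> A then omega
       else if (vs ! j, vs ! i) \<in> A then cnj omega
       else 1
     else 0)"

definition D_mat :: "'v list \<Rightarrow> 'v set set \<Rightarrow> complex mat" where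
  "D_mat vs E = mat (length vs) (length vs) (\<lambda>(i, j).
     if i = j then of_nat (card {e \<in> E. vs ! i \<in> e}) else 0)"

definition L_mat :: "'v list \<Rightarrow> 'v set set \<Rightarrow> ('v \<times> 'v) set \<Rightarrow> complex mat" where
  "L_mat vs E A = D_mat vs E - N_mat vs E A"

definition principal_submatrix :: "'a mat \<Rightarrow> 'v list \<Rightarrow> 'v set \<Rightarrow> 'a mat" where
  "principal_submatrix M vs W =
     submatrix M {i. i < length vs \<and> vs ! i \<in> W} {i. i < length vs \<and> vs ! i \<in> W}"

text \<open>A substructure is a pair of a vertex set \<open>W\<close> and an edge set \<open>F\<close>, where the edges in \<open>F\<close> are
  still the two-element sets of \<open>E\<close>, even if one or both endpoints are not in \<open>W\<close>.
  Its components are the connected components of the bipartite incidence graph on the disjoint sum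
  of \<open>W\<close> and \<open>F\<close>, so an edge without endpoint in \<open>W\<close> is a component on its own.\<close>

definition incidence :: "'v set \<Rightarrow> 'v set set \<Rightarrow> (('v + 'v set) \<times> ('v + 'v set)) set" where
  "incidence W F =
     {(Inl v, Inr e) | v e. v \<in> W \<and> e \<in> F \<and> v \<in> e} \<union>
     {(Inr e, Inl v) | v e. v \<in> W \<and> e \<in> F \<and> v \<in> e}"

definition substructure_components :: "'v set \<Rightarrow> 'v set set \<Rightarrow> ('v set \<times> 'v set set) set" where
  "substructure_components W F =
     (\<lambda>K. (Inl -` K, Inr -` K)) ` ((W <+> F) // (incidence W F)\<^sup>*)"

text \<open>A cyclic traversal of a cycle is the list of its vertices in cyclic order; the cycle itself is
  identified with its set of edges.\<close>

definition cycle_edges :: "'v list \<Rightarrow> 'v set set" where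
  "cycle_edges c = {{c ! i, c ! (Suc i mod length c)} | i. i < length c}"

definition is_traversal :: "'v set set \<Rightarrow> 'v list \<Rightarrow> bool" where
  "is_traversal F c \<longleftrightarrow> 3 \<le> length c \<and> distinct c \<and> cycle_edges c \<subseteq> F"

definition cycles :: "'v set set \<Rightarrow> 'v set set set" where
  "cycles F = {cycle_edges c | c. is_traversal F c}"

definition is_tree :: "'v set \<Rightarrow> 'v set set \<Rightarrow> bool" where
  "is_tree W F \<longleftrightarrow> (\<forall>e\<in>F. e \<subseteq> W) \<and> connected_graph W F \<and> cycles F = {}"

definition rootless_tree :: "'v set \<times> 'v set set \<Rightarrow> bool" where
  "rootless_tree = (\<lambda>(W, F).
     is_tree W {e \<in> F. e \<subseteq> W} \<and> (\<exists>!e. e \<in> F \<and> card (e \<inter> W) = 1))"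

definition unicyclic :: "'v set \<times> 'v set set \<Rightarrow> bool" where
  "unicyclic = (\<lambda>(W, F).
     (\<forall>e\<in>F. e \<subseteq> W) \<and> connected_graph W F \<and> (\<exists>!Z. Z \<in> cycles F))"

definition forward_arcs :: "('v \<times> 'v) set \<Rightarrow> 'v list \<Rightarrow> nat" where
  "forward_arcs A c = card {i. i < length c \<and> (c ! i, c ! (Suc i mod length c)) \<in> A}"

definition backward_arcs :: "('v \<times> 'v) set \<Rightarrow> 'v list \<Rightarrow> nat" where
  "backward_arcs A c = card {i. i < length c \<and> (c ! (Suc i mod length c), c ! i) \<in> A}"

definition arc_excess :: "('v \<times> 'v) set \<Rightarrow> 'v list \<Rightarrow> int" where
  "arc_excess A c = int (forward_arcs A c) - int (backward_arcs A c)"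

text \<open>Membership of a unicyclic graph in a class. Reversing the traversal negates \<^const>\<open>arc_excess\<close>,
  and each set of residues is closed under negation modulo 6, so the choice of the traversal of the
  unique cycle is immaterial.\<close>

definition in_Phi2 :: "('v \<times> 'v) set \<Rightarrow> 'v set \<times> 'v set set \<Rightarrow> bool" where
  "in_Phi2 A = (\<lambda>(W, F). \<exists>c. is_traversal F c \<and> arc_excess A c mod 6 \<in> {2, 4})"

definition in_Phi3 :: "('v \<times> 'v) set \<Rightarrow> 'v set \<times> 'v set set \<Rightarrow> bool" where
  "in_Phi3 A = (\<lambda>(W, F). \<exists>c. is_traversal F c \<and> arc_excess A c mod 6 = 3)"

definition in_Phi4 :: "('v \<times> 'v) set \<Rightarrow> 'v set \<times> 'v set set \<Rightarrow> bool" where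
  "in_Phi4 A = (\<lambda>(W, F). \<exists>c. is_traversal F c \<and> arc_excess A c mod 6 = 0)"

definition type_I :: "('v \<times> 'v) set \<Rightarrow> 'v set \<Rightarrow> 'v set set \<Rightarrow> bool" where
  "type_I A W F \<longleftrightarrow> card W = card F \<and>
     (\<forall>K \<in> substructure_components W F. rootless_tree K \<or> (unicyclic K \<and> \<not> in_Phi4 A K))"

definition gamma1 :: "('v \<times> 'v) set \<Rightarrow> 'v set \<Rightarrow> 'v set set \<Rightarrow> nat" where
  "gamma1 A W F = card {K \<in> substructure_components W F. unicyclic K \<and> in_Phi2 A K}"

definition gamma2 :: "('v \<times> 'v) set \<Rightarrow> 'v set \<Rightarrow> 'v set set \<Rightarrow> nat" where
  "gamma2 A W F = card {K \<in> substructure_components W F. unicyclic K \<and> in_Phi3 A K}"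

end

theory Submission
  imports Defs "HOL-Combinatorics.Cycles"
begin

text \<open>Row \<open>v\<close> of the Laplacian is the sum, over the edges \<open>e\<close> at \<open>v\<close>, of a row with entry 1 at \<open>v\<close> and
  minus the gain of \<open>e\<close> at the other endpoint. Expanding the determinant in all rows gives a sum over
  the choices \<open>f\<close> of an edge \<open>f v\<close> at every \<open>v\<close> in \<open>V1\<close>. If \<open>f\<close> is not injective then two rows are
  proportional, so the choices can be grouped by their image \<open>E1\<close>, with \<open>card E1 = card V1\<close>.

  For fixed \<open>E1\<close> both this partial sum and the product of the component weights are computed by
  peeling. A vertex without edges makes both vanish, and removing a vertex of degree one together
  with its edge changes neither, since the determinants become block triangular. If all degrees
  are at least two, then \<open>card E1 = card V1\<close> forces every degree to be exactly two, so there is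
  a cycle which is a whole component. It admits exactly two choices, its two orientations, and they
  contribute \<open>1 - w\<close> and \<open>1 - cnj w\<close>, where \<open>w\<close> is a power of \<open>omega\<close> with exponent the arc excess; the
  sum \<open>2 - 2 Re w\<close> takes the values 0, 1, 3, 4.\<close>

section \<open>Determinants indexed by finite sets\<close>

text \<open>The Leibniz sum indexed by the vertices themselves, so that blocks on subsets of
  \<open>W\<close> need no renumbering.\<close>

definition set_det :: "'v set \<Rightarrow> ('v \<Rightarrow> 'v \<Rightarrow> 'a :: comm_ring_1) \<Rightarrow> 'a" where
  "set_det W a = (\<Sum>p | p permutes W. of_int (sign p) * (\<Prod>v\<in>W. a v (p v)))"

lemma set_det_cong:
  assumes "\<And>u v. u \<in> W \<Longrightarrow> v \<in> W \<Longrightarrow> a u v = b u v"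
  shows "set_det W a = set_det W b"
  unfolding set_det_def
  using assms by (intro sum.cong refl arg_cong2[of _ _ _ _ "(*)"] prod.cong)
    (auto simp: permutes_in_image)

lemma set_det_empty [simp]: "set_det {} a = 1"
  by (simp add: set_det_def)

lemma set_det_singleton [simp]: "set_det {v} a = a v v"
  by (simp add: set_det_def)

text \<open>Conjugation by \<open>h\<close> turns permutations of \<open>I\<close> into permutations
  of \<open>W\<close> and keeps the sign.\<close>

lemma set_det_reindex:
  assumes h: "bij_betw h I W" and I: "finite I"
  shows "set_det W a = set_det I (\<lambda>i j. a (h i) (h j))"
proof -
  define g where "g = inv_into I h"
  have g: "bij_betw g W I" unfolding g_def using h by (rule bij_betw_inv_into)
  have gh: "g (h i) = i" if "i \<in> I" for i
    using h that by (simp add: g_def bij_betw_def)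
  have hg: "h (g w) = w" if "w \<in> W" for w
    using h that by (simp add: g_def bij_betw_inv_into_right)
  have inj: "inj_on h I" using h by (simp add: bij_betw_def)
  show ?thesis
    unfolding set_det_def
  proof (rule sum.reindex_bij_witness[of _ "map_permutation I h" "map_permutation W g"])
    fix p assume "p \<in> {p. p permutes W}"
    hence p: "p permutes W" by simp
    let ?q = "map_permutation W g p"
    show "map_permutation I h ?q = p"
      by (rule map_permutation_compose_inv[OF g p hg])
    show q: "?q \<in> {p. p permutes I}"
      using map_permutation_permutes[OF g p] by simp
    have sgn: "sign ?q = sign p"
      using g h I p by (intro sign_map_permutation) (auto simp: bij_betw_def)
    have "(\<Prod>v\<in>W. a v (p v)) = (\<Prod>i\<in>I. a (h i) (p (h i)))"
      by (rule prod.reindex_bij_betw[OF h, symmetric])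
    also have "\<dots> = (\<Prod>i\<in>I. a (h i) (h (?q i)))"
    proof (intro prod.cong refl)
      fix i assume i: "i \<in> I"
      have hi: "h i \<in> W" using h i by (auto simp: bij_betw_def)
      have "?q (g (h i)) = g (p (h i))"
        using g hi by (intro map_permutation_apply) (auto simp: bij_betw_def)
      then show "a (h i) (p (h i)) = a (h i) (h (?q i))"
        using gh[OF i] hg p hi by (simp add: permutes_in_image)
    qed
    finally show "of_int (sign ?q) * (\<Prod>i\<in>I. a (h i) (h (?q i))) =
        of_int (sign p) * (\<Prod>v\<in>W. a v (p v))"
      by (simp add: sgn)
  next
    fix p assume "p \<in> {p. p permutes I}"
    hence p: "p permutes I" by simp
    show "map_permutation W g (map_permutation I h p) = p"
      by (rule map_permutation_compose_inv[OF h p gh])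
    show "map_permutation I h p \<in> {p. p permutes W}"
      using map_permutation_permutes[OF h p] by simp
  qed
qed

lemma bij_betw_pick:
  assumes "finite S"
  shows "bij_betw (pick S) {0..<card S} S"
proof -
  have "inj_on (pick S) {0..<card S}"
  proof (rule linorder_inj_onI)
    fix i j assume "i < j" "i \<in> {0..<card S}" "j \<in> {0..<card S}"
    then show "pick S i \<noteq> pick S j" using pick_mono[of j S i] by simp
  qed auto
  moreover have "pick S ` {0..<card S} \<subseteq> S"
    using pick_in_set by auto
  ultimately show ?thesis
    using assms by (simp add: bij_betw_def card_image card_subset_eq)
qed

text \<open>\<open>submatrix\<close> renumbers the selected positions by \<open>pick\<close>.
  Composed with the listing \<open>vs\<close>, this is a bijection from the matrix indices onto
  \<open>W\<close>, so reindexing removes both the numbering and the listing.\<close>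

lemma det_principal_submatrix:
  assumes vs: "distinct vs" and W: "W \<subseteq> set vs"
    and M: "M = mat (length vs) (length vs) (\<lambda>(i, j). m (vs ! i) (vs ! j))"
  shows "det (principal_submatrix M vs W) = set_det W m"
proof -
  define I where "I = {i. i < length vs \<and> vs ! i \<in> W}"
  have fin: "finite I" by (simp add: I_def)
  have I_eq: "{i. i < length vs \<and> i \<in> I} = I" by (auto simp: I_def)
  have h: "bij_betw ((!) vs) I W"
  proof (rule bij_betw_imageI)
    show "inj_on ((!) vs) I" using vs by (auto simp: I_def inj_on_def nth_eq_iff_index_eq)
    show "(!) vs ` I = W"
    proof
      show "W \<subseteq> (!) vs ` I"
      proof
        fix w assume "w \<in> W"
        then obtain i where "i < length vs" "vs ! i = w" using W by (meson in_set_conv_nth subsetD)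
        then show "w \<in> (!) vs ` I" using \<open>w \<in> W\<close> by (auto simp: I_def)
      qed
    qed (auto simp: I_def)
  qed
  have dims: "dim_row (principal_submatrix M vs W) = card I" "dim_col (principal_submatrix M vs W) = card I"
    by (simp_all add: principal_submatrix_def submatrix_def M I_eq flip: I_def)
  have entry: "principal_submatrix M vs W $$ (i, j) = m (vs ! pick I i) (vs ! pick I j)"
    if "i < card I" "j < card I" for i j
  proof -
    have "pick I i \<in> I" "pick I j \<in> I" using that pick_in_set by auto
    then show ?thesis
      using that by (simp add: principal_submatrix_def submatrix_def M I_eq flip: I_def) (simp add: I_def)
  qed
  have "det (principal_submatrix M vs W) = set_det {0..<card I} (\<lambda>i j. principal_submatrix M vs W $$ (i, j))"
    by (simp add: det_def dims set_det_def)
  also have "\<dots> = set_det {0..<card I} (\<lambda>i j. m (vs ! pick I i) (vs ! pick I j))"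
    by (rule set_det_cong) (simp add: entry)
  also have "\<dots> = set_det W m"
    using set_det_reindex[OF bij_betw_trans[OF bij_betw_pick[OF fin] h], of m] by simp
  finally show ?thesis .
qed

lemma set_det_sum_rows:
  assumes W: "finite W" and B: "\<And>v. v \<in> W \<Longrightarrow> finite (B v)"
  shows "set_det W (\<lambda>v u. \<Sum>e\<in>B v. m e v u) = (\<Sum>f\<in>PiE W B. set_det W (\<lambda>v. m (f v) v))"
  unfolding set_det_def
  by (subst sum.swap) (simp add: prod_sum_PiE[OF assms] sum_distrib_left)

text \<open>Composing \<open>p\<close> with the transposition of \<open>u\<close> and
  \<open>v\<close> flips the sign, while the product is unchanged: after \<open>c\<close> is pulled
  out, both factors come from row \<open>v\<close>. Hence the determinant is its own negative, and
  characteristic zero makes it vanish.\<close>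

lemma set_det_proportional_rows:
  fixes a :: "'v \<Rightarrow> 'v \<Rightarrow> 'a :: {idom, ring_char_0}"
  assumes W: "finite W" and uv: "u \<in> W" "v \<in> W" "u \<noteq> v"
    and pro: "\<And>w. w \<in> W \<Longrightarrow> a u w = c * a v w"
  shows "set_det W a = 0"
proof -
  let ?t = "transpose u v"
  let ?T = "\<lambda>p. of_int (sign p) * (\<Prod>w\<in>W. a w (p w)) :: 'a"
  have t: "?t permutes W" using uv by (intro permutes_swap_id)
  have split: "(\<Prod>w\<in>W. b w) = b u * (b v * (\<Prod>w\<in>W - {u} - {v}. b w))" for b :: "'v \<Rightarrow> 'a"
    using W uv prod.remove[of W u b] prod.remove[of "W - {u}" v b] by simp
  have "?T (p \<circ> ?t) = - ?T p" if p: "p permutes W" for p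
  proof -
    have "sign (p \<circ> ?t) = - sign p"
      using p t W uv by (simp add: sign_compose permutes_imp_permutation sign_swap_id)
    moreover have "(\<Prod>w\<in>W - {u} - {v}. a w ((p \<circ> ?t) w)) = (\<Prod>w\<in>W - {u} - {v}. a w (p w))"
      by (intro prod.cong refl) (auto simp: transpose_def)
    ultimately show ?thesis
      using p uv by (simp add: split permutes_in_image pro)
  qed
  then have "set_det W a = (\<Sum>p | p permutes W. - ?T p)"
    unfolding set_det_def by (subst sum_permutations_compose_right[OF t]) (intro sum.cong, auto)
  then have "set_det W a = - set_det W a"
    by (simp add: set_det_def sum_negf)
  then show ?thesis
    by (simp add: eq_neg_iff_add_eq_0 flip: mult_2)
qed

text \<open>A permutation sending some element of \<open>W2\<close> into \<open>W1\<close> meets a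
  zero entry. Any other one maps \<open>W2\<close> onto itself by finiteness, hence also
  \<open>W1\<close>, and is a unique product of a permutation of each block.\<close>

lemma set_det_block_triangular:
  fixes a :: "'v \<Rightarrow> 'v \<Rightarrow> 'a :: comm_ring_1"
  assumes fin: "finite W1" "finite W2" and disj: "W1 \<inter> W2 = {}"
    and zero: "\<And>v u. v \<in> W2 \<Longrightarrow> u \<in> W1 \<Longrightarrow> a v u = 0"
  shows "set_det (W1 \<union> W2) a = set_det W1 a * set_det W2 a"
proof -
  let ?T = "\<lambda>W p. of_int (sign p) * (\<Prod>v\<in>W. a v (p v)) :: 'a"
  let ?P = "{p. p permutes W1} \<times> {p. p permutes W2}"
  let ?Q = "{p. p permutes W1 \<union> W2 \<and> p ` W2 \<subseteq> W2}"
  have "set_det (W1 \<union> W2) a = (\<Sum>p\<in>?Q. ?T (W1 \<union> W2) p)"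
    unfolding set_det_def
  proof (rule sum.mono_neutral_right)
    show "\<forall>p\<in>{p. p permutes W1 \<union> W2} - ?Q. ?T (W1 \<union> W2) p = 0"
    proof
      fix p assume p: "p \<in> {p. p permutes W1 \<union> W2} - ?Q"
      then obtain v where v: "v \<in> W2" "p v \<notin> W2" by auto
      from p have "p permutes W1 \<union> W2" by simp
      then have "p v \<in> W1" using v permutes_in_image[of p "W1 \<union> W2" v] by auto
      then have "a v (p v) = 0" using v zero by simp
      then have "(\<Prod>v\<in>W1 \<union> W2. a v (p v)) = 0"
        using v fin by (intro prod_zero) auto
      then show "?T (W1 \<union> W2) p = 0" by simp
    qed
  qed (use fin in \<open>auto simp: finite_permutations\<close>)
  also have "\<dots> = (\<Sum>(p, q)\<in>?P. ?T W1 p * ?T W2 q)"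
  proof (rule sum.reindex_bij_witness[of _ "\<lambda>(p, q). p \<circ> q" "\<lambda>p. (restrict_id p W1, restrict_id p W2)"])
    fix p assume "p \<in> ?Q"
    then have p: "p permutes W1 \<union> W2" and "p ` W2 \<subseteq> W2" by auto
    have im2: "p ` W2 = W2"
      by (rule endo_inj_surj[OF fin(2) \<open>p ` W2 \<subseteq> W2\<close> permutes_inj_on[OF p]])
    have "p ` W1 \<union> p ` W2 = W1 \<union> W2"
      using permutes_image[OF p] by (simp add: image_Un)
    moreover have "p ` W1 \<inter> p ` W2 = {}"
      using disj image_Int[OF permutes_inj[OF p], of W1 W2] by simp
    ultimately have im1: "p ` W1 = W1"
      using disj unfolding im2 by (metis Diff_cancel Diff_triv Un_Diff sup_bot_right)
    have b: "bij_betw p W1 W1" "bij_betw p W2 W2"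
      unfolding bij_betw_def using im1 im2 permutes_inj_on[OF p, of W1] permutes_inj_on[OF p, of W2] by simp_all
    show "(restrict_id p W1, restrict_id p W2) \<in> ?P"
      using b by (simp add: permutes_restrict_id)
    have comp: "restrict_id p W1 \<circ> restrict_id p W2 = p"
    proof
      fix x show "(restrict_id p W1 \<circ> restrict_id p W2) x = p x"
      proof (cases "x \<in> W2")
        case True
        then have "p x \<in> W2" "p x \<notin> W1" using im2 disj by auto
        then show ?thesis using True by simp
      next
        case False
        then show ?thesis using permutes_not_in[OF p, of x] by (cases "x \<in> W1") simp_all
      qed
    qed
    then show "(case (restrict_id p W1, restrict_id p W2) of (p, q) \<Rightarrow> p \<circ> q) = p"
      by (simp only: prod.case)
    have "sign (restrict_id p W1 \<circ> restrict_id p W2) = sign (restrict_id p W1) * sign (restrict_id p W2)"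
      by (intro sign_compose permutes_imp_permutation[OF fin(1)] permutes_imp_permutation[OF fin(2)]
          permutes_restrict_id b)
    then have "sign p = sign (restrict_id p W1) * sign (restrict_id p W2)"
      by (simp only: comp)
    then show "(case (restrict_id p W1, restrict_id p W2) of (p, q) \<Rightarrow> ?T W1 p * ?T W2 q) = ?T (W1 \<union> W2) p"
      using prod.union_disjoint[OF fin disj, of "\<lambda>v. a v (p v)"]
      by (simp only: prod.case restrict_id_simps of_int_mult mult_ac cong: prod.cong)
  next
    fix pq assume "pq \<in> ?P"
    then obtain p q where pq: "pq = (p, q)" and p: "p permutes W1" and q: "q permutes W2" by auto
    have "p \<circ> q permutes W1 \<union> W2"
      by (intro permutes_compose permutes_subset[OF p] permutes_subset[OF q]) auto
    moreover have pq2: "(p \<circ> q) x = q x" "q x \<in> W2" if "x \<in> W2" for x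
    proof -
      show "q x \<in> W2" using q that by (simp add: permutes_in_image)
      then have "q x \<notin> W1" using disj by auto
      then show "(p \<circ> q) x = q x" by (simp add: permutes_not_in[OF p])
    qed
    then have "(p \<circ> q) ` W2 \<subseteq> W2" by auto
    ultimately show "(case pq of (p, q) \<Rightarrow> p \<circ> q) \<in> ?Q" by (simp only: pq prod.case mem_Collect_eq)
    have "restrict_id (p \<circ> q) W1 = p"
    proof
      show "restrict_id (p \<circ> q) W1 x = p x" for x
      proof (cases "x \<in> W1")
        case True
        then have "x \<notin> W2" using disj by auto
        then show ?thesis using True by (simp add: permutes_not_in[OF q])
      qed (simp add: permutes_not_in[OF p])
    qed
    moreover have "restrict_id (p \<circ> q) W2 = q"
    proof
      show "restrict_id (p \<circ> q) W2 x = q x" for x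
        using pq2[of x] by (cases "x \<in> W2") (simp_all add: permutes_not_in[OF q])
    qed
    ultimately show "(restrict_id (case pq of (p, q) \<Rightarrow> p \<circ> q) W1, restrict_id (case pq of (p, q) \<Rightarrow> p \<circ> q) W2) = pq"
      by (simp only: pq prod.case)
  qed
  also have "\<dots> = set_det W1 a * set_det W2 a"
    unfolding set_det_def sum_product sum.cartesian_product ..
  finally show ?thesis .
qed

section \<open>Cyclic permutations and their determinants\<close>

lemma sign_cycle_of_list:
  assumes "distinct c" "c \<noteq> []"
  shows "sign (cycle_of_list c) = (-1) ^ (length c - 1)"
  using assms
proof (induction c rule: cycle_of_list.induct)
  case (1 i j cs)
  have "sign (transpose i j \<circ> cycle_of_list (j # cs)) = - sign (cycle_of_list (j # cs))"
    using 1 by (subst sign_compose) (simp_all add: permutation_of_cycle sign_swap_id permutation_swap_id)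
  then show ?case using 1 by (simp add: o_def)
qed auto

lemma cycle_of_list_nth:
  assumes "distinct c" "i < length c"
  shows "cycle_of_list c (c ! i) = c ! (Suc i mod length c)"
proof -
  have "map (cycle_of_list c) c = rotate1 c"
    using cyclic_rotation[OF assms(1), of 1] by (simp add: rotate_def)
  then show ?thesis
    using assms by (metis nth_map nth_rotate1)
qed

text \<open>A permutation that contributes maps every vertex either to itself or to its successor under
  \<open>g\<close>; since \<open>g\<close> is transitive, only the identity and \<open>g\<close> itself do.\<close>

lemma set_det_cyclic:
  fixes b :: "'v \<Rightarrow> 'a :: comm_ring_1"
  assumes W: "finite W" "W \<noteq> {}" and g: "g permutes W" and sgn: "sign g = (-1) ^ (card W - 1)"
    and trans: "\<And>S. S \<subseteq> W \<Longrightarrow> S \<noteq> {} \<Longrightarrow> g ` S \<subseteq> S \<Longrightarrow> S = W"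
    and fp: "\<And>v. v \<in> W \<Longrightarrow> g v \<noteq> v"
  shows "set_det W (\<lambda>v u. if u = v then 1 else if u = g v then - b v else 0) = 1 - (\<Prod>v\<in>W. b v)"
proof -
  let ?a = "\<lambda>v u. if u = v then 1 else if u = g v then - b v else 0 :: 'a"
  let ?T = "\<lambda>p. of_int (sign p) * (\<Prod>v\<in>W. ?a v (p v)) :: 'a"
  have gid: "id \<noteq> g" using W fp by (metis all_not_in_conv id_apply)
  have "set_det W ?a = (\<Sum>p\<in>{id, g}. ?T p)"
    unfolding set_det_def
  proof (rule sum.mono_neutral_right)
    show "\<forall>p\<in>{p. p permutes W} - {id, g}. ?T p = 0"
    proof (rule ballI, rule ccontr)
      fix p assume p: "p \<in> {p. p permutes W} - {id, g}" and nz: "?T p \<noteq> 0"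
      then have pW: "p permutes W" by simp
      have "?a v (p v) \<noteq> 0" if "v \<in> W" for v
      proof
        assume "?a v (p v) = 0"
        then have "(\<Prod>v\<in>W. ?a v (p v)) = 0"
          using that W by (intro prod_zero) blast+
        then show False using nz by simp
      qed
      then have alt: "p v = v \<or> p v = g v" if "v \<in> W" for v
        using that by (metis (full_types))
      \<comment> \<open>\<open>S\<close> is closed under \<open>g\<close>: once \<open>p\<close>
        moves \<open>v\<close> to \<open>g v\<close>, injectivity forbids it to fix
        \<open>g v\<close>, so it must move that vertex along \<open>g\<close> as well.\<close>
      define S where "S = {v \<in> W. p v = g v}"
      have "g v \<in> S" if "v \<in> S" for v
      proof -
        have v: "v \<in> W" "p v = g v" using that by (auto simp: S_def)
        then have gv: "g v \<in> W" using g by (simp add: permutes_in_image)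
        have "p (g v) \<noteq> p v" using permutes_inj[OF pW] fp[OF v(1)] by (metis injD)
        then have "p (g v) = g (g v)" using alt[OF gv] v by auto
        then show ?thesis using gv by (simp add: S_def)
      qed
      then have "S = {} \<or> S = W" using trans[of S] by (auto simp: S_def)
      then show False
      proof
        assume "S = {}"
        then have "p x = id x" for x
          using alt permutes_not_in[OF pW] by (cases "x \<in> W") (auto simp: S_def)
        then have "p = id" by (rule ext)
        then show False using p by simp
      next
        assume "S = W"
        then have "p x = g x" for x
          using permutes_not_in[OF pW] permutes_not_in[OF g] by (cases "x \<in> W") (auto simp: S_def)
        then have "p = g" by (rule ext)
        then show False using p by simp
      qed
    qed
  qed (use W g in \<open>auto simp: finite_permutations\<close>)
  also have "\<dots> = 1 + of_int (sign g) * (\<Prod>v\<in>W. - b v)"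
    using gid fp by simp
  \<comment> \<open>The product carries \<open>card W\<close> factors -1 and the sign of
    \<open>g\<close> carries one fewer, so a single minus survives. The exponent is written as a
    successor to make this cancellation visible.\<close>
  also have "(\<Prod>v\<in>W. - b v) = (-1) ^ Suc (card W - 1) * (\<Prod>v\<in>W. b v)"
    using W by (simp add: prod_uminus card_gt_0_iff)
  also have "1 + of_int (sign g) * \<dots> = 1 - (\<Prod>v\<in>W. b v)"
    by (cases "even (card W - 1)") (simp_all add: sgn)
  finally show ?thesis .
qed

section \<open>Components of substructures\<close>

text \<open>A possibly empty union of components of the incidence graph, described without paths.
  Only endpoints in \<open>W\<close> count, so an endpoint outside \<open>W\<close> never links two
  edges.\<close>

definition closed_part :: "'v set \<Rightarrow> 'v set set \<Rightarrow> 'v set \<Rightarrow> 'v set set \<Rightarrow> bool" where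
  "closed_part W F W1 F1 \<longleftrightarrow>
     W1 \<subseteq> W \<and> F1 \<subseteq> F \<and> (\<forall>v\<in>W. \<forall>e\<in>F. v \<in> e \<longrightarrow> (v \<in> W1 \<longleftrightarrow> e \<in> F1))"

definition indecomposable :: "'v set \<Rightarrow> 'v set set \<Rightarrow> bool" where
  "indecomposable W F \<longleftrightarrow> (W \<noteq> {} \<or> F \<noteq> {}) \<and>
     (\<forall>W1 F1. closed_part W F W1 F1 \<and> (W1 \<noteq> {} \<or> F1 \<noteq> {}) \<longrightarrow> W1 = W \<and> F1 = F)"

lemma closed_part_trans:
  "closed_part W F W1 F1 \<Longrightarrow> closed_part W1 F1 W2 F2 \<Longrightarrow> closed_part W F W2 F2"
  unfolding closed_part_def by blast

lemma closed_part_subset: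
  "closed_part W F W2 F2 \<Longrightarrow> W2 \<subseteq> W1 \<Longrightarrow> F2 \<subseteq> F1 \<Longrightarrow> W1 \<subseteq> W \<Longrightarrow> F1 \<subseteq> F \<Longrightarrow> closed_part W1 F1 W2 F2"
  unfolding closed_part_def by blast

lemma closed_part_Diff: "closed_part W F W1 F1 \<Longrightarrow> closed_part W F (W - W1) (F - F1)"
  unfolding closed_part_def by blast

lemma closed_part_Int:
  "closed_part W F W1 F1 \<Longrightarrow> closed_part W F W2 F2 \<Longrightarrow> closed_part W F (W1 \<inter> W2) (F1 \<inter> F2)"
  unfolding closed_part_def by blast

lemma indecomposableD:
  "indecomposable W F \<Longrightarrow> closed_part W F W1 F1 \<Longrightarrow> W1 \<noteq> {} \<or> F1 \<noteq> {} \<Longrightarrow> W1 = W \<and> F1 = F"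
  unfolding indecomposable_def by blast

lemma closed_part_reachable:
  assumes cl: "closed_part W F W1 F1" and "(x, y) \<in> (incidence W F)\<^sup>*" "x \<in> W1 <+> F1"
  shows "y \<in> W1 <+> F1"
  using assms(2,3)
proof (induction rule: rtrancl_induct)
  case (step y z)
  then have y: "y \<in> W1 <+> F1" by simp
  from step(2) show ?case
    unfolding incidence_def
  proof (elim UnE CollectE exE conjE)
    fix v e assume "(y, z) = (Inl v, Inr e)" "v \<in> W" "e \<in> F" "v \<in> e"
    then show ?thesis using y cl by (auto simp: closed_part_def)
  next
    fix v e assume "(y, z) = (Inr e, Inl v)" "v \<in> W" "e \<in> F" "v \<in> e"
    then show ?thesis using y cl by (auto simp: closed_part_def)
  qed
qed

lemma incidence_sym: "(x, y) \<in> (incidence W F)\<^sup>* \<Longrightarrow> (y, x) \<in> (incidence W F)\<^sup>*"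
proof -
  have "sym (incidence W F)" by (auto simp: sym_def incidence_def)
  then show "(x, y) \<in> (incidence W F)\<^sup>* \<Longrightarrow> (y, x) \<in> (incidence W F)\<^sup>*"
    using sym_rtrancl symD by metis
qed

lemma closed_part_class:
  assumes x: "x \<in> W <+> F"
  defines "K \<equiv> (incidence W F)\<^sup>* `` {x}"
  shows "closed_part W F (Inl -` K) (Inr -` K)"
proof -
  have "closed_part W F W F" by (simp add: closed_part_def)
  then have K: "K \<subseteq> W <+> F"
    using x by (auto simp: K_def dest: closed_part_reachable)
  show ?thesis
    unfolding closed_part_def
  proof (intro conjI ballI impI iffI)
    show "Inl -` K \<subseteq> W" "Inr -` K \<subseteq> F" using K by auto
  next
    fix v e assume ve: "v \<in> W" "e \<in> F" "v \<in> e"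
    have "(Inl v, Inr e) \<in> incidence W F" "(Inr e, Inl v) \<in> incidence W F"
      using ve by (auto simp: incidence_def)
    then show "v \<in> Inl -` K \<Longrightarrow> e \<in> Inr -` K" "e \<in> Inr -` K \<Longrightarrow> v \<in> Inl -` K"
      unfolding K_def by (auto intro: rtrancl_into_rtrancl)
  qed
qed

text \<open>Components are the minimal nonempty closed parts. A closed part inside a class contains
  everything reachable from each of its elements, hence by symmetry the whole class. This trades
  reachability for closure conditions.\<close>

lemma substructure_components_iff:
  "(W1, F1) \<in> substructure_components W F \<longleftrightarrow> closed_part W F W1 F1 \<and> indecomposable W1 F1"
proof
  assume "(W1, F1) \<in> substructure_components W F"
  then obtain x where x: "x \<in> W <+> F" and
    K: "W1 = Inl -` ((incidence W F)\<^sup>* `` {x})" "F1 = Inr -` ((incidence W F)\<^sup>* `` {x})"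
    by (auto simp: substructure_components_def quotient_def)
  have cl: "closed_part W F W1 F1"
    unfolding K by (rule closed_part_class[OF x])
  have mem: "y \<in> W1 <+> F1 \<longleftrightarrow> (x, y) \<in> (incidence W F)\<^sup>*" for y
    by (cases y) (auto simp: K)
  have "indecomposable W1 F1"
    unfolding indecomposable_def
  proof (intro conjI allI impI)
    have "x \<in> W1 <+> F1" by (simp add: mem)
    then show "W1 \<noteq> {} \<or> F1 \<noteq> {}" by auto
  next
    fix W2 F2 assume 2: "closed_part W1 F1 W2 F2 \<and> (W2 \<noteq> {} \<or> F2 \<noteq> {})"
    then have cl2: "closed_part W F W2 F2" using closed_part_trans[OF cl] by blast
    have sub: "W2 \<subseteq> W1" "F2 \<subseteq> F1" using 2 by (auto simp: closed_part_def)
    obtain y where y: "y \<in> W2 <+> F2" using 2 by auto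
    then have "y \<in> W1 <+> F1" using sub by auto
    then have yx: "(y, x) \<in> (incidence W F)\<^sup>*" using mem incidence_sym by blast
    have "W1 <+> F1 \<subseteq> W2 <+> F2"
    proof
      fix z assume "z \<in> W1 <+> F1"
      then have "(y, z) \<in> (incidence W F)\<^sup>*" using yx mem by (meson rtrancl_trans)
      then show "z \<in> W2 <+> F2" using closed_part_reachable[OF cl2] y by blast
    qed
    then show "W2 = W1" "F2 = F1" using sub by auto
  qed
  with cl show "closed_part W F W1 F1 \<and> indecomposable W1 F1" ..
next
  assume 1: "closed_part W F W1 F1 \<and> indecomposable W1 F1"
  then obtain x where x: "x \<in> W1 <+> F1" by (auto simp: indecomposable_def)
  define K where "K = (incidence W F)\<^sup>* `` {x}"
  have sub: "W1 \<subseteq> W" "F1 \<subseteq> F" using 1 by (auto simp: closed_part_def)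
  then have xW: "x \<in> W <+> F" using x by auto
  have KS: "K \<subseteq> W1 <+> F1"
    using closed_part_reachable[of W F W1 F1] 1 x by (auto simp: K_def)
  then have "closed_part W1 F1 (Inl -` K) (Inr -` K)"
    by (intro closed_part_subset[OF closed_part_class[OF xW, folded K_def] _ _ sub]) auto
  moreover have "Inl -` K \<noteq> {} \<or> Inr -` K \<noteq> {}"
  proof -
    have "x \<in> K" by (simp add: K_def)
    then show ?thesis by (cases x) auto
  qed
  ultimately have "Inl -` K = W1 \<and> Inr -` K = F1" using 1 indecomposableD by blast
  moreover have "K \<in> (W <+> F) // (incidence W F)\<^sup>*"
    using xW unfolding K_def by (rule quotientI)
  ultimately show "(W1, F1) \<in> substructure_components W F"
    unfolding substructure_components_def by force
qed

lemma finite_substructure_components: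
  assumes "finite W" "finite F"
  shows "finite (substructure_components W F)"
proof (rule finite_subset)
  show "substructure_components W F \<subseteq> Pow W \<times> Pow F"
  proof
    fix K assume K: "K \<in> substructure_components W F"
    obtain W1 F1 where "K = (W1, F1)" by (cases K)
    then show "K \<in> Pow W \<times> Pow F"
      using K by (simp add: substructure_components_iff closed_part_def)
  qed
qed (use assms in simp)

text \<open>The intersection of a component with a closed part is closed, so a component that meets
  the closed part lies inside it.\<close>

lemma substructure_components_split:
  assumes cl: "closed_part W F W1 F1"
  shows "substructure_components W F =
      substructure_components W1 F1 \<union> substructure_components (W - W1) (F - F1)" (is "?L = ?R")
proof (intro subset_antisym subsetI)
  fix K assume K: "K \<in> ?L"
  obtain W2 F2 where K_eq: "K = (W2, F2)" by (cases K)
  have cl2: "closed_part W F W2 F2" and ind: "indecomposable W2 F2"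
    using K by (auto simp: K_eq substructure_components_iff)
  have sub: "W1 \<subseteq> W" "F1 \<subseteq> F" "W2 \<subseteq> W" "F2 \<subseteq> F"
    using cl cl2 by (auto simp: closed_part_def)
  have *: "W2 \<subseteq> W' \<and> F2 \<subseteq> F'" if "closed_part W F W' F'" "W2 \<inter> W' \<noteq> {} \<or> F2 \<inter> F' \<noteq> {}" for W' F'
  proof -
    have "closed_part W2 F2 (W2 \<inter> W') (F2 \<inter> F')"
      using closed_part_Int[OF cl2 that(1)] sub by (rule_tac closed_part_subset[of W F]) auto
    then show ?thesis using indecomposableD[OF ind] that(2) by blast
  qed
  show "K \<in> ?R"
  proof (cases "W2 \<inter> W1 \<noteq> {} \<or> F2 \<inter> F1 \<noteq> {}")
    case True
    then have "closed_part W1 F1 W2 F2"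
      using *[OF cl] sub cl2 closed_part_subset by blast
    then show ?thesis using ind by (simp add: K_eq substructure_components_iff)
  next
    case False
    then have "closed_part (W - W1) (F - F1) W2 F2"
      using sub by (intro closed_part_subset[OF cl2]) auto
    then show ?thesis using ind by (simp add: K_eq substructure_components_iff)
  qed
next
  fix K assume "K \<in> ?R"
  then show "K \<in> ?L"
    using closed_part_trans[OF cl] closed_part_trans[OF closed_part_Diff[OF cl]]
    by (cases K) (auto simp: substructure_components_iff)
qed

lemma substructure_components_disjoint:
  assumes "W1 \<inter> W2 = {}" "F1 \<inter> F2 = {}"
  shows "substructure_components W1 F1 \<inter> substructure_components W2 F2 = {}"
proof -
  have False if "K \<in> substructure_components W1 F1" "K \<in> substructure_components W2 F2" for K
  proof (cases K)
    case (Pair W F)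
    then have "W \<subseteq> W1 \<inter> W2" "F \<subseteq> F1 \<inter> F2" "W \<noteq> {} \<or> F \<noteq> {}"
      using that by (auto simp: substructure_components_iff closed_part_def indecomposable_def)
    then show ?thesis using assms by simp
  qed
  then show ?thesis by blast
qed

lemma substructure_components_indecomposable:
  assumes "indecomposable W F"
  shows "substructure_components W F = {(W, F)}"
proof (intro subset_antisym subsetI)
  fix K assume K: "K \<in> substructure_components W F"
  obtain W1 F1 where "K = (W1, F1)" by (cases K)
  moreover from this have "closed_part W F W1 F1" "W1 \<noteq> {} \<or> F1 \<noteq> {}"
    using K by (simp_all add: substructure_components_iff indecomposable_def)
  ultimately show "K \<in> {(W, F)}"
    using indecomposableD[OF assms] by blast
next
  fix K assume "K \<in> {(W, F)}"
  then show "K \<in> substructure_components W F"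
    using assms by (simp add: substructure_components_iff closed_part_def)
qed

lemma substructure_component_of_vertex:
  assumes "v \<in> W"
  obtains W1 F1 where "v \<in> W1" "closed_part W F W1 F1" "indecomposable W1 F1"
proof -
  let ?K = "(incidence W F)\<^sup>* `` {Inl v}"
  have "?K \<in> (W <+> F) // (incidence W F)\<^sup>*"
    using assms by (intro quotientI) auto
  then have "(Inl -` ?K, Inr -` ?K) \<in> substructure_components W F"
    by (auto simp: substructure_components_def)
  then have "closed_part W F (Inl -` ?K) (Inr -` ?K) \<and> indecomposable (Inl -` ?K) (Inr -` ?K)"
    by (simp only: substructure_components_iff)
  then show thesis by (intro that[of "Inl -` ?K" "Inr -` ?K"]) auto
qed

text \<open>The set reachable from a vertex is itself closed under adjacency; conversely a closed
  set contains whatever is reachable from its elements.\<close>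

lemma connected_graph_iff:
  assumes F: "\<forall>e\<in>F. e \<subseteq> W"
  shows "connected_graph W F \<longleftrightarrow> W \<noteq> {} \<and>
    (\<forall>S. S \<subseteq> W \<and> S \<noteq> {} \<and> (\<forall>x y. {x, y} \<in> F \<longrightarrow> x \<in> S \<longrightarrow> y \<in> S) \<longrightarrow> S = W)"
    (is "_ \<longleftrightarrow> _ \<and> (\<forall>S. ?closed S \<longrightarrow> S = W)")
proof (intro iffI conjI allI impI)
  assume con: "connected_graph W F"
  then show "W \<noteq> {}" by (simp add: connected_graph_def)
  fix S assume S: "?closed S"
  then obtain u where u: "u \<in> S" by auto
  have "v \<in> S" if "(u, v) \<in> {(x, y). {x, y} \<in> F}\<^sup>*" for v
    using that by (induction rule: rtrancl_induct) (use S u in auto)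
  then show "S = W"
    using con u S unfolding connected_graph_def by blast
next
  assume *: "W \<noteq> {} \<and> (\<forall>S. ?closed S \<longrightarrow> S = W)"
  let ?R = "{(x, y). {x, y} \<in> F}"
  have "?R\<^sup>* `` {u} = W" if u: "u \<in> W" for u
  proof -
    have "v \<in> W" if "(u, v) \<in> ?R\<^sup>*" for v
      using that by (induction rule: rtrancl_induct) (use F u in auto)
    then have "?R\<^sup>* `` {u} \<subseteq> W" by blast
    moreover have "u \<in> ?R\<^sup>* `` {u}" by simp
    moreover have "y \<in> ?R\<^sup>* `` {u}" if "{x, y} \<in> F" "x \<in> ?R\<^sup>* `` {u}" for x y
      using that by (auto intro: rtrancl_into_rtrancl)
    ultimately have "?closed (?R\<^sup>* `` {u})" by blast
    then show ?thesis using * by blast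
  qed
  then show "connected_graph W F"
    using * unfolding connected_graph_def by blast
qed

section \<open>Weights of components and of substructures\<close>

definition component_weight :: "('v \<times> 'v) set \<Rightarrow> 'v set \<times> 'v set set \<Rightarrow> complex" where
  "component_weight A K =
     (if rootless_tree K \<or> (unicyclic K \<and> \<not> in_Phi4 A K)
      then (if unicyclic K \<and> in_Phi2 A K then 3 else 1) * (if unicyclic K \<and> in_Phi3 A K then 4 else 1)
      else 0)"

text \<open>Components forbidden in type I have weight 0, so this product encodes both the type I
  condition and the summand, and is multiplicative over closed parts. The factors 3 and 4 are
  separate in \<open>component_weight\<close> because \<open>gamma1\<close> and
  \<open>gamma2\<close> count independently.\<close>

definition weight :: "('v \<times> 'v) set \<Rightarrow> 'v set \<Rightarrow> 'v set set \<Rightarrow> complex" where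
  "weight A W F = (\<Prod>K\<in>substructure_components W F. component_weight A K)"

lemma weight_eq_type_I:
  assumes fin: "finite W" "finite F" and card: "card W = card F"
  shows "weight A W F = (if type_I A W F then 3 ^ gamma1 A W F * 4 ^ gamma2 A W F else 0)"
proof (cases "type_I A W F")
  case True
  let ?C = "substructure_components W F"
  have finC: "finite ?C" using fin by (rule finite_substructure_components)
  have "weight A W F = (\<Prod>K\<in>?C. (if unicyclic K \<and> in_Phi2 A K then 3 else 1) *
      (if unicyclic K \<and> in_Phi3 A K then 4 else 1))"
    unfolding weight_def using True by (intro prod.cong) (auto simp: component_weight_def type_I_def)
  also have "\<dots> = 3 ^ gamma1 A W F * 4 ^ gamma2 A W F"
    using finC by (simp add: prod.distrib gamma1_def gamma2_def prod.If_cases Int_def)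
  finally show ?thesis using True by simp
next
  case False
  then obtain K where "K \<in> substructure_components W F" "component_weight A K = 0"
    using card by (auto simp: type_I_def component_weight_def)
  then have "weight A W F = 0"
    unfolding weight_def using fin by (intro prod_zero finite_substructure_components) auto
  then show ?thesis using False by simp
qed

lemma weight_empty [simp]: "weight A {} {} = 1"
proof -
  have "substructure_components {} {} = ({} :: ('a set \<times> 'a set set) set)"
    by (auto simp: substructure_components_iff closed_part_def indecomposable_def)
  then show ?thesis by (simp add: weight_def)
qed

lemma weight_indecomposable: "indecomposable W F \<Longrightarrow> weight A W F = component_weight A (W, F)"
  by (simp add: weight_def substructure_components_indecomposable)

lemma weight_split:
  assumes "finite W" "finite F" and cl: "closed_part W F W1 F1"
  shows "weight A W F = weight A W1 F1 * weight A (W - W1) (F - F1)"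
proof -
  have "W1 \<subseteq> W" "F1 \<subseteq> F" using cl by (auto simp: closed_part_def)
  then have "finite W1" "finite F1" using assms by (auto intro: finite_subset)
  then show ?thesis
    unfolding weight_def substructure_components_split[OF cl] using assms
    by (intro prod.union_disjoint finite_substructure_components substructure_components_disjoint) auto
qed

section \<open>Cycles and the removal of leaves\<close>

lemma cycle_edges_altdef: "cycle_edges c = (\<lambda>i. {c ! i, c ! (Suc i mod length c)}) ` {..<length c}"
  by (auto simp: cycle_edges_def)

lemma cycles_empty [simp]: "cycles {} = {}"
  by (auto simp: cycles_def is_traversal_def cycle_edges_altdef lessThan_empty_iff)

lemma Union_cycle_edges: "\<Union>(cycle_edges c) = set c"
proof -
  have "c ! (Suc i mod length c) \<in> set c" if "i < length c" for i
    using that by (intro nth_mem mod_less_divisor) auto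
  then show ?thesis
    by (auto simp: cycle_edges_altdef in_set_conv_nth Bex_def)
qed

lemma cyclic_predecessor:
  assumes "3 \<le> n" "i < n"
  obtains j where "j < n" "Suc j mod n = i" "j \<noteq> i" "j \<noteq> Suc i mod n"
proof (cases i)
  case 0
  then show ?thesis using assms by (intro that[of "n - 1"]) auto
next
  case (Suc k)
  moreover have "k \<noteq> Suc i mod n"
    using assms Suc by (cases "Suc i = n") auto
  ultimately show ?thesis using assms by (intro that[of k]) auto
qed

text \<open>These are the edges to the cyclic successor and predecessor; they differ because a cycle
  has at least three vertices.\<close>

lemma two_cycle_edges_at_vertex:
  assumes "3 \<le> length c" "distinct c" "v \<in> set c"
  obtains e1 e2 where "e1 \<in> cycle_edges c" "e2 \<in> cycle_edges c" "e1 \<noteq> e2" "v \<in> e1" "v \<in> e2"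
proof -
  obtain i where i: "i < length c" "c ! i = v" using assms(3) by (auto simp: in_set_conv_nth)
  obtain j where j: "j < length c" "Suc j mod length c = i" "j \<noteq> i" "j \<noteq> Suc i mod length c"
    using cyclic_predecessor[OF assms(1) i(1)] by blast
  have k: "Suc i mod length c < length c" using i(1) by (intro mod_less_divisor) auto
  show thesis
  proof (rule that[of "{c ! i, c ! (Suc i mod length c)}" "{c ! j, c ! i}"])
    show "{c ! i, c ! (Suc i mod length c)} \<noteq> {c ! j, c ! i}"
      using assms(2) i j k by (auto simp: doubleton_eq_iff nth_eq_iff_index_eq)
    show "{c ! j, c ! i} \<in> cycle_edges c" using j by (auto simp: cycle_edges_def)
  qed (use i in \<open>auto simp: cycle_edges_def\<close>)
qed

text \<open>A cycle using \<open>e\<close> would pass through \<open>v\<close> and need a second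
  edge there.\<close>

lemma is_traversal_insert_leaf:
  assumes "\<forall>f\<in>F. v \<notin> f" "v \<in> e"
  shows "is_traversal (insert e F) c \<longleftrightarrow> is_traversal F c"
proof
  assume c: "is_traversal (insert e F) c"
  then have c': "3 \<le> length c" "distinct c" "cycle_edges c \<subseteq> insert e F" by (auto simp: is_traversal_def)
  have "v \<notin> set c"
  proof
    assume "v \<in> set c"
    then obtain e1 e2 where "e1 \<in> cycle_edges c" "e2 \<in> cycle_edges c" "e1 \<noteq> e2" "v \<in> e1" "v \<in> e2"
      using two_cycle_edges_at_vertex[OF c'(1,2)] by blast
    then show False using c'(3) assms by blast
  qed
  then have "e \<notin> cycle_edges c" using Union_cycle_edges[of c] assms(2) by blast
  then show "is_traversal F c" using c' by (auto simp: is_traversal_def)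
qed (auto simp: is_traversal_def)

lemma connected_graph_insert_leaf:
  assumes F: "\<forall>f\<in>F. f \<subseteq> W" and u: "u \<in> W" and v: "v \<notin> W"
  shows "connected_graph (insert v W) (insert {v, u} F) \<longleftrightarrow> connected_graph W F"
proof -
  have F': "\<forall>f\<in>insert {v, u} F. f \<subseteq> insert v W" using F u by auto
  have vF: "{x, y} \<in> F \<Longrightarrow> x \<noteq> v \<and> y \<noteq> v" for x y using F v by auto
  show ?thesis
    unfolding connected_graph_iff[OF F] connected_graph_iff[OF F']
  proof (intro iffI conjI allI impI; (elim conjE)?)
    fix S
    assume *: "\<forall>S. S \<subseteq> insert v W \<and> S \<noteq> {} \<and>
        (\<forall>x y. {x, y} \<in> insert {v, u} F \<longrightarrow> x \<in> S \<longrightarrow> y \<in> S) \<longrightarrow> S = insert v W"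
      and S: "S \<subseteq> W" "S \<noteq> {}" "\<forall>x y. {x, y} \<in> F \<longrightarrow> x \<in> S \<longrightarrow> y \<in> S"
    \<comment> \<open>A set closed in the smaller graph stays closed if it gains \<open>v\<close>
      exactly when it contains the neighbour \<open>u\<close>.\<close>
    let ?S = "if u \<in> S then insert v S else S"
    have "?S = insert v W"
    proof (rule *[rule_format], intro conjI allI impI)
      fix x y assume xy: "{x, y} \<in> insert {v, u} F" "x \<in> ?S"
      show "y \<in> ?S"
      proof (cases "{x, y} = {v, u}")
        case True
        then show ?thesis using xy S(1) v by (auto simp: doubleton_eq_iff split: if_splits)
      next
        case False
        then have "{x, y} \<in> F" using xy by auto
        then have "y \<in> S" using S(3) vF xy(2) by (metis insertE)
        then show ?thesis by auto
      qed
    qed (use S in auto)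
    then show "S = W" using S(1) v by (auto split: if_splits)
  next
    fix S
    assume *: "\<forall>S. S \<subseteq> W \<and> S \<noteq> {} \<and> (\<forall>x y. {x, y} \<in> F \<longrightarrow> x \<in> S \<longrightarrow> y \<in> S) \<longrightarrow> S = W"
      and S: "S \<subseteq> insert v W" "S \<noteq> {}" "\<forall>x y. {x, y} \<in> insert {v, u} F \<longrightarrow> x \<in> S \<longrightarrow> y \<in> S"
    have vu: "v \<in> S \<longleftrightarrow> u \<in> S" using S(3) by (metis insertI1 insert_commute)
    have "S \<inter> W = W"
    proof (rule *[rule_format], intro conjI allI impI)
      show "S \<inter> W \<noteq> {}" using S(1,2) vu u by auto
      fix x y assume "{x, y} \<in> F" "x \<in> S \<inter> W"
      then show "y \<in> S \<inter> W" using S(3) F by auto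
    qed auto
    then show "S = insert v W" using S(1) u vu by auto
  qed (use u in auto)
qed

text \<open>The pendant edge lies on no cycle, preserves connectedness, and has both endpoints in
  the enlarged vertex set, so the edges with a single endpoint there stay the same. All ingredients
  of the weight are thus unaffected.\<close>

lemma component_weight_insert_leaf:
  assumes u: "u \<in> W" and v: "v \<notin> W" and vF: "\<forall>f\<in>F. v \<notin> f"
  shows "component_weight A (insert v W, insert {v, u} F) = component_weight A (W, F)"
proof -
  have uv: "u \<noteq> v" using u v by auto
  have trav: "is_traversal (insert {v, u} G) = is_traversal G" if "G \<subseteq> F" for G
    using is_traversal_insert_leaf[of G v "{v, u}"] vF that by (auto simp: fun_eq_iff)
  then have cyc: "cycles (insert {v, u} G) = cycles G" if "G \<subseteq> F" for G
    using that by (simp add: cycles_def)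
  have inner: "{f \<in> insert {v, u} F. f \<subseteq> insert v W} = insert {v, u} {f \<in> F. f \<subseteq> W}"
    using u vF by auto
  have half: "f \<in> insert {v, u} F \<and> card (f \<inter> insert v W) = 1 \<longleftrightarrow> f \<in> F \<and> card (f \<inter> W) = 1" for f
  proof (cases "f = {v, u}")
    case True
    then have "f \<inter> insert v W = {v, u}" using u by auto
    then show ?thesis using True uv vF by auto
  next
    case False
    then have "f \<in> F \<Longrightarrow> f \<inter> insert v W = f \<inter> W" using vF by auto
    then show ?thesis using False by (cases "f \<in> F") simp_all
  qed
  have sub: "(\<forall>f\<in>insert {v, u} F. f \<subseteq> insert v W) \<longleftrightarrow> (\<forall>f\<in>F. f \<subseteq> W)"
    using u vF by auto
  have con: "connected_graph (insert v W) (insert {v, u} {f \<in> F. f \<subseteq> W}) = connected_graph W {f \<in> F. f \<subseteq> W}"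
    using u v by (intro connected_graph_insert_leaf) auto
  have sub': "(\<forall>f\<in>insert {v, u} {f \<in> F. f \<subseteq> W}. f \<subseteq> insert v W)" using u by auto
  have "rootless_tree (insert v W, insert {v, u} F) = rootless_tree (W, F)"
    unfolding rootless_tree_def is_tree_def prod.case inner half
    using con sub' cyc[of "{f \<in> F. f \<subseteq> W}"] by auto
  moreover have "unicyclic (insert v W, insert {v, u} F) = unicyclic (W, F)"
    unfolding unicyclic_def prod.case sub cyc[OF subset_refl]
    using connected_graph_insert_leaf[of F W u v] u v by auto
  ultimately show ?thesis
    unfolding component_weight_def by (simp add: in_Phi2_def in_Phi3_def in_Phi4_def trav)
qed

text \<open>Let \<open>u\<close> be the other endpoint of \<open>e\<close>. If \<open>u\<close> is
  outside \<open>W\<close>, then \<open>v\<close> and \<open>e\<close> form a component, a rootless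
  tree of weight 1. Otherwise the component of \<open>v\<close> is the component of \<open>u\<close>
  in the remainder with a leaf attached, and all other components are shared.\<close>

lemma weight_peel_leaf:
  assumes fin: "finite W" "finite F" and two: "\<forall>f\<in>F. card f = 2"
    and v: "v \<in> W" and e: "{f \<in> F. v \<in> f} = {e}"
  shows "weight A W F = weight A (W - {v}) (F - {e})"
proof -
  have eF: "e \<in> F" "v \<in> e" and only: "f \<in> F \<Longrightarrow> v \<in> f \<Longrightarrow> f = e" for f using e by auto
  have "card e = 2" using two eF by simp
  then obtain x y where "e = {x, y}" "x \<noteq> y" unfolding card_2_iff by blast
  define u where "u = (if v = x then y else x)"
  have eu: "e = {v, u}" and uv: "u \<noteq> v"
    using \<open>e = {x, y}\<close> \<open>x \<noteq> y\<close> eF(2) unfolding u_def by auto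
  show ?thesis
  proof (cases "u \<in> W")
    case False
    have cl: "closed_part W F {v} {e}"
      unfolding closed_part_def
    proof (intro conjI ballI impI)
      fix w f assume "w \<in> W" "f \<in> F" "w \<in> f"
      then show "w \<in> {v} \<longleftrightarrow> f \<in> {e}" using only[of f] eu False by auto
    qed (use v eF in auto)
    have ind: "indecomposable {v} {e}"
      unfolding indecomposable_def
    proof (intro conjI allI impI)
      fix W1 F1 assume 1: "closed_part {v} {e} W1 F1 \<and> (W1 \<noteq> {} \<or> F1 \<noteq> {})"
      then have "v \<in> W1 \<longleftrightarrow> e \<in> F1" "W1 \<subseteq> {v}" "F1 \<subseteq> {e}"
        using eF(2) by (auto simp: closed_part_def)
      then show "W1 = {v}" "F1 = {e}" using 1 by auto
    qed simp
    have none: "{f. f = e \<and> f \<subseteq> {v}} = {}" using eu uv by auto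
    have tree: "is_tree {v} {}"
      by (simp add: is_tree_def connected_graph_def)
    have "e \<inter> {v} = {v}" using eu by auto
    then have "\<exists>!f. f = e \<and> card (f \<inter> {v}) = 1"
      by (intro ex1I[of _ e]) simp_all
    then have "rootless_tree ({v}, {e})"
      using tree by (simp add: rootless_tree_def none)
    moreover have "\<not> unicyclic ({v}, {e})"
      using eu uv by (auto simp: unicyclic_def)
    ultimately have "weight A {v} {e} = 1"
      by (simp add: weight_indecomposable[OF ind] component_weight_def)
    then show ?thesis using weight_split[OF fin cl, of A] by simp
  next
    case True
    let ?W = "W - {v}" and ?F = "F - {e}"
    obtain W0 F0 where uW0: "u \<in> W0" and cl0: "closed_part ?W ?F W0 F0" and ind0: "indecomposable W0 F0"
      using substructure_component_of_vertex[of u ?W ?F] True uv by blast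
    have sub: "W0 \<subseteq> ?W" "F0 \<subseteq> ?F" using cl0 by (auto simp: closed_part_def)
    have vW0: "v \<notin> W0" and vF0: "\<forall>f\<in>F0. v \<notin> f" using sub only by auto
    have iff0: "w \<in> W0 \<longleftrightarrow> f \<in> F0" if "w \<in> ?W" "f \<in> ?F" "w \<in> f" for w f
      using cl0 that by (auto simp: closed_part_def)
    have cl: "closed_part W F (insert v W0) (insert e F0)"
      unfolding closed_part_def
    proof (intro conjI ballI impI)
      fix w f assume wf: "w \<in> W" "f \<in> F" "w \<in> f"
      show "w \<in> insert v W0 \<longleftrightarrow> f \<in> insert e F0"
      proof (cases "f = e")
        case True
        then show ?thesis using wf eu uW0 by auto
      next
        case False
        then have "w \<noteq> v" using only wf by auto
        then show ?thesis using iff0[of w f] wf False by auto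
      qed
    qed (use v eF sub in auto)
    have ind: "indecomposable (insert v W0) (insert e F0)"
      unfolding indecomposable_def
    proof (intro conjI allI impI)
      fix W1 F1 assume 1: "closed_part (insert v W0) (insert e F0) W1 F1 \<and> (W1 \<noteq> {} \<or> F1 \<noteq> {})"
      \<comment> \<open>The edge \<open>e\<close> ties \<open>v\<close> to \<open>u\<close>: a
        closed part contains all three or none of them. A nonempty one therefore meets the old
        component.\<close>
      have eq: "v \<in> W1 \<longleftrightarrow> e \<in> F1" "u \<in> W1 \<longleftrightarrow> e \<in> F1"
        using 1 eu uW0 by (auto simp: closed_part_def)
      have sub1: "W1 \<subseteq> insert v W0" "F1 \<subseteq> insert e F0" using 1 by (auto simp: closed_part_def)
      have "closed_part W0 F0 (W1 \<inter> W0) (F1 \<inter> F0)"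
        using 1 unfolding closed_part_def by blast
      moreover have "W1 \<inter> W0 \<noteq> {} \<or> F1 \<inter> F0 \<noteq> {}"
      proof (cases "u \<in> W1")
        case False
        then have "v \<notin> W1" "e \<notin> F1" using eq by auto
        then show ?thesis using 1 sub1 by blast
      qed (use uW0 in auto)
      ultimately have "W1 \<inter> W0 = W0 \<and> F1 \<inter> F0 = F0" by (rule indecomposableD[OF ind0])
      then have "W0 \<subseteq> W1" "F0 \<subseteq> F1" by auto
      then show "W1 = insert v W0" "F1 = insert e F0" using uW0 eq sub1 by auto
    qed simp
    have "weight A W F = component_weight A (insert v W0, insert e F0) *
        weight A (W - insert v W0) (F - insert e F0)"
      using weight_split[OF fin cl] weight_indecomposable[OF ind] by simp
    also have "W - insert v W0 = ?W - W0" by auto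
    also have "F - insert e F0 = ?F - F0" by auto
    also have "component_weight A (insert v W0, insert e F0) = component_weight A (W0, F0)"
      unfolding eu by (rule component_weight_insert_leaf[OF uW0 vW0 vF0])
    also have "component_weight A (W0, F0) * weight A (?W - W0) (?F - F0) = weight A ?W ?F"
      using weight_split[OF _ _ cl0] weight_indecomposable[OF ind0] fin by simp
    finally show ?thesis .
  qed
qed

text \<open>The vertex alone is a component, with neither the one-endpoint edge of a rootless tree
  nor a cycle.\<close>

lemma weight_isolated_vertex:
  assumes fin: "finite W" "finite F" and v: "v \<in> W" and e: "{f \<in> F. v \<in> f} = {}"
  shows "weight A W F = 0"
proof -
  have cl: "closed_part W F {v} {}" using v e by (auto simp: closed_part_def)
  have ind: "indecomposable {v} {}"
    unfolding indecomposable_def closed_part_def by auto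
  have "component_weight A ({v}, {}) = 0"
    by (simp add: component_weight_def rootless_tree_def unicyclic_def Ex1_def)
  then show ?thesis
    using weight_split[OF fin cl] weight_indecomposable[OF ind] by simp
qed

section \<open>Matchings of vertices to edges\<close>

text \<open>Nonadjacent pairs get the default 1 too; whether an edge is present is tested in
  \<open>edge_row\<close>.\<close>

definition gain :: "('v \<times> 'v) set \<Rightarrow> 'v \<Rightarrow> 'v \<Rightarrow> complex" where
  "gain A u v = (if (u, v) \<in> A then omega else if (v, u) \<in> A then cnj omega else 1)"

lemma omega_add_cnj: "omega + cnj omega = 1"
  by (simp add: omega_def complex_eq_iff)

lemma omega_mult_cnj [simp]: "omega * cnj omega = 1" "cnj omega * omega = 1"
  by (simp_all add: omega_def complex_eq_iff power2_eq_square flip: real_sqrt_mult)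

lemma cnj_omega: "cnj omega = 1 - omega"
  using omega_add_cnj by (simp add: algebra_simps)

lemma omega_square: "omega * omega = omega - 1"
  using omega_mult_cnj(1) by (simp add: cnj_omega algebra_simps)

lemma gain_mult_gain:
  assumes "asym A"
  shows "gain A u v * gain A v u = 1"
  using assms by (auto simp: gain_def dest: asymD)

lemma cnj_gain:
  assumes "asym A"
  shows "cnj (gain A u v) = gain A v u"
  using assms by (auto simp: gain_def dest: asymD)

text \<open>\<open>edge_row A e v\<close> is row \<open>v\<close> of the rank-one summand of \<open>e\<close> in the Laplacian; it is meaningful
  for \<open>v \<in> e\<close> only, as its diagonal entry is 1 regardless.\<close>

definition edge_row :: "('v \<times> 'v) set \<Rightarrow> 'v set \<Rightarrow> 'v \<Rightarrow> 'v \<Rightarrow> complex" where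
  "edge_row A e v u = (if u = v then 1 else if e = {v, u} then - gain A v u else 0)"

text \<open>Extensionality fixes the values outside \<open>W\<close>, so that the matchings are
  exactly the injective choices in \<open>PiE\<close> with image \<open>F\<close>.\<close>

definition matchings :: "'v set \<Rightarrow> 'v set set \<Rightarrow> ('v \<Rightarrow> 'v set) set" where
  "matchings W F = {f \<in> extensional W. bij_betw f W F \<and> (\<forall>v\<in>W. v \<in> f v)}"

definition matching_sum :: "('v \<times> 'v) set \<Rightarrow> 'v set \<Rightarrow> 'v set set \<Rightarrow> complex" where
  "matching_sum A W F = (\<Sum>f\<in>matchings W F. set_det W (\<lambda>v. edge_row A (f v) v))"

lemma set_det_edge_row_restrict:
  "W \<subseteq> W' \<Longrightarrow> set_det W (\<lambda>v. edge_row A (restrict f W' v) v) = set_det W (\<lambda>v. edge_row A (f v) v)"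
  by (rule set_det_cong) auto

text \<open>Only one direction of incidence is excluded: an edge of \<open>F1\<close> may meet \<open>W - W1\<close>, which makes
  the matrices block triangular.\<close>

lemma matching_sum_split:
  assumes fin: "finite W" "finite F" and sub: "W1 \<subseteq> W" "F1 \<subseteq> F" and card: "card W1 = card F1"
    and inc: "\<And>v e. v \<in> W1 \<Longrightarrow> e \<in> F \<Longrightarrow> v \<in> e \<Longrightarrow> e \<in> F1"
  shows "matching_sum A W F = matching_sum A W1 F1 * matching_sum A (W - W1) (F - F1)"
proof -
  let ?W2 = "W - W1" and ?F2 = "F - F1"
  let ?D = "\<lambda>W f. set_det W (\<lambda>v. edge_row A (f v) v)"
  have W: "W1 \<union> ?W2 = W" using sub by auto
  have fin1: "finite W1" "finite F1" using fin sub by (auto intro: finite_subset)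
  have "matching_sum A W F = (\<Sum>(f, g)\<in>matchings W1 F1 \<times> matchings ?W2 ?F2. ?D W1 f * ?D ?W2 g)"
    unfolding matching_sum_def
  proof (rule sum.reindex_bij_witness[of _ "\<lambda>(f, g) v. if v \<in> W1 then f v else g v"
        "\<lambda>f. (restrict f W1, restrict f ?W2)"])
    fix f assume f: "f \<in> matchings W F"
    then have inj: "inj_on f W" and im: "f ` W = F" and ext: "f \<in> extensional W" and mem: "\<forall>v\<in>W. v \<in> f v"
      by (auto simp: matchings_def bij_betw_def)
    \<comment> \<open>Vertices of \<open>W1\<close> can choose only edges of \<open>F1\<close>, and
      by equal cardinality they use up all of them. This leaves exactly \<open>F - F1\<close> for
      the other vertices.\<close>
    have "f ` W1 \<subseteq> F1" using inc mem im sub by auto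
    moreover have "card (f ` W1) = card F1"
      using card inj sub by (metis card_image inj_on_subset)
    ultimately have im1: "f ` W1 = F1" using fin1 by (simp add: card_subset_eq)
    have im2: "f ` ?W2 = ?F2" using inj_on_image_set_diff[OF inj, of W W1] sub im im1 by auto
    have bij: "bij_betw f W1 F1" "bij_betw f ?W2 ?F2"
      using im1 im2 inj sub by (auto simp: bij_betw_def intro: inj_on_subset)
    have "bij_betw (restrict f W1) W1 F1" "bij_betw (restrict f ?W2) ?W2 ?F2"
      by (rule bij_betw_cong[THEN iffD2, OF _ bij(1)], simp)
        (rule bij_betw_cong[THEN iffD2, OF _ bij(2)], simp)
    then show "(restrict f W1, restrict f ?W2) \<in> matchings W1 F1 \<times> matchings ?W2 ?F2"
      unfolding matchings_def using mem sub by (simp add: subset_iff)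
    show "(case (restrict f W1, restrict f ?W2) of (f, g) \<Rightarrow> \<lambda>v. if v \<in> W1 then f v else g v) = f"
    proof
      show "(case (restrict f W1, restrict f ?W2) of (f, g) \<Rightarrow> \<lambda>v. if v \<in> W1 then f v else g v) x = f x" for x
        using extensional_arb[OF ext, of x] by simp
    qed
    have "?D (W1 \<union> ?W2) f = ?D W1 f * ?D ?W2 f"
    proof (rule set_det_block_triangular)
      fix v u assume v: "v \<in> ?W2" and u: "u \<in> W1"
      \<comment> \<open>An edge outside \<open>F1\<close> has no endpoint in \<open>W1\<close>, so
        row \<open>v\<close> is zero on the columns of \<open>W1\<close>.\<close>
      have "f v \<in> ?F2" using im2 v by blast
      then have "f v \<noteq> {v, u}" using inc[OF u, of "f v"] by auto
      then show "edge_row A (f v) v u = 0" using u v by (auto simp: edge_row_def)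
    qed (use fin fin1 in auto)
    then show "(case (restrict f W1, restrict f ?W2) of (f, g) \<Rightarrow> ?D W1 f * ?D ?W2 g) = ?D W f"
      by (simp only: prod.case W set_det_edge_row_restrict[OF subset_refl])
  next
    fix fg assume "fg \<in> matchings W1 F1 \<times> matchings ?W2 ?F2"
    then obtain f g where fg: "fg = (f, g)" and f: "f \<in> matchings W1 F1" and g: "g \<in> matchings ?W2 ?F2"
      by auto
    let ?h = "\<lambda>v. if v \<in> W1 then f v else g v"
    have "bij_betw ?h (W1 \<union> ?W2) (F1 \<union> ?F2)"
      using f g by (intro bij_betw_disjoint_Un) (auto simp: matchings_def)
    then have "bij_betw ?h W F" using sub by (simp add: Un_absorb1)
    moreover have "?h \<in> extensional W" "\<forall>v\<in>W. v \<in> ?h v"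
      using f g sub by (auto simp: matchings_def extensional_def)
    ultimately show "(case fg of (f, g) \<Rightarrow> \<lambda>v. if v \<in> W1 then f v else g v) \<in> matchings W F"
      by (simp add: fg matchings_def)
    have "restrict ?h W1 = f"
      using f by (auto simp: matchings_def fun_eq_iff extensional_def)
    moreover have "restrict ?h ?W2 = g"
      using g by (auto simp: matchings_def fun_eq_iff extensional_def)
    ultimately show "(restrict (case fg of (f, g) \<Rightarrow> \<lambda>v. if v \<in> W1 then f v else g v) W1,
        restrict (case fg of (f, g) \<Rightarrow> \<lambda>v. if v \<in> W1 then f v else g v) ?W2) = fg"
      by (simp only: fg prod.case)
  qed
  then show ?thesis
    by (simp only: matching_sum_def sum_product sum.cartesian_product)
qed

lemma matching_sum_empty [simp]: "matching_sum A {} {} = 1"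
proof -
  have "matchings ({} :: 'a set) {} = {\<lambda>_. undefined}"
    by (auto simp: matchings_def bij_betw_def)
  then show ?thesis by (simp add: matching_sum_def)
qed

lemma matching_sum_isolated_vertex:
  assumes "v \<in> W" "{f \<in> F. v \<in> f} = {}"
  shows "matching_sum A W F = 0"
proof -
  have "matchings W F = {}"
    using assms by (auto simp: matchings_def bij_betw_def)
  then show ?thesis by (simp add: matching_sum_def)
qed

text \<open>The only edge \<open>v\<close> can choose is \<open>e\<close>, and its one-by-one
  determinant is 1. The other endpoint of \<open>e\<close> may remain in \<open>W - {v}\<close>,
  which the block triangular splitting allows.\<close>

lemma matching_sum_peel_leaf:
  assumes fin: "finite W" "finite F" and v: "v \<in> W" and e: "{f \<in> F. v \<in> f} = {e}"
  shows "matching_sum A W F = matching_sum A (W - {v}) (F - {e})"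
proof -
  have "v \<in> e" "e \<in> F" using e by auto
  have "matchings {v} {e} = {\<lambda>w\<in>{v}. e}"
    using \<open>v \<in> e\<close> by (auto simp: matchings_def bij_betw_def fun_eq_iff extensional_def)
  then have "matching_sum A {v} {e} = 1"
    by (simp add: matching_sum_def edge_row_def)
  moreover have "matching_sum A W F = matching_sum A {v} {e} * matching_sum A (W - {v}) (F - {e})"
    using fin v e by (intro matching_sum_split) auto
  ultimately show ?thesis by simp
qed

text \<open>A cycle given by its successor map; \<open>g_neq\<close> and \<open>g_g_neq\<close>
  exclude lengths one and two. The conditions are invariant under inversion, so each fact about one
  orientation also holds for the other.\<close>

locale cyclic_permutation =
  fixes W :: "'v set" and g :: "'v \<Rightarrow> 'v"
  assumes finite_W: "finite W" and W_nonempty: "W \<noteq> {}"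
    and g_permutes: "g permutes W"
    and g_sign: "sign g = (-1) ^ (card W - 1)"
    and g_transitive: "S \<subseteq> W \<Longrightarrow> S \<noteq> {} \<Longrightarrow> g ` S \<subseteq> S \<Longrightarrow> S = W"
    and g_neq: "v \<in> W \<Longrightarrow> g v \<noteq> v"
    and g_g_neq: "v \<in> W \<Longrightarrow> g (g v) \<noteq> v"
begin

definition edges :: "'v set set" where
  "edges = (\<lambda>v. {v, g v}) ` W"

abbreviation h where "h \<equiv> inv_into UNIV g"

lemma gh [simp]: "g (h v) = v" "h (g v) = v"
  using permutes_inverses[OF g_permutes] by auto

lemma g_in [simp]: "g v \<in> W \<longleftrightarrow> v \<in> W" and h_in [simp]: "h v \<in> W \<longleftrightarrow> v \<in> W"
  using permutes_in_image[OF g_permutes] permutes_in_image[OF permutes_inv[OF g_permutes]] by auto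

lemma inverse: "cyclic_permutation W h"
proof
  show "h permutes W" using g_permutes by (rule permutes_inv)
  show "sign h = (-1) ^ (card W - 1)"
    using g_sign sign_inverse[OF permutes_imp_permutation[OF finite_W g_permutes]] by simp
  show "S = W" if S: "S \<subseteq> W" "S \<noteq> {}" "h ` S \<subseteq> S" for S
  proof -
    \<comment> \<open>An injective map of a finite set into itself is onto, so closure under
      \<open>h\<close> becomes closure under \<open>g\<close>.\<close>
    have "inj_on h S" by (metis gh(1) inj_onI)
    then have "h ` S = S"
      using S finite_W by (intro endo_inj_surj) (auto intro: finite_subset)
    then have "g ` S = (\<lambda>v. g (h v)) ` S" by (metis image_image)
    then show ?thesis using S g_transitive[of S] by simp
  qed
  show "h v \<noteq> v" if "v \<in> W" for v using that g_neq[of "h v"] by auto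
  show "h (h v) \<noteq> v" if "v \<in> W" for v using that g_g_neq[of "h (h v)"] by auto
qed (use finite_W W_nonempty in auto)

lemma edges_altdef: "edges = (\<lambda>v. {v, h v}) ` W"
proof -
  have "{v, g v} \<in> (\<lambda>v. {v, h v}) ` W" if "v \<in> W" for v
    using that by (intro image_eqI[of _ _ "g v"]) (auto simp: insert_commute)
  moreover have "{v, h v} \<in> (\<lambda>v. {v, g v}) ` W" if "v \<in> W" for v
    using that by (intro image_eqI[of _ _ "h v"]) (auto simp: insert_commute)
  ultimately show ?thesis unfolding edges_def by blast
qed

lemma edges_subset: "\<forall>e\<in>edges. e \<subseteq> W"
  by (auto simp: edges_def)

lemma edges_at: "v \<in> W \<Longrightarrow> {e \<in> edges. v \<in> e} = {{v, g v}, {v, h v}}"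
proof (intro subset_antisym subsetI)
  fix e assume "e \<in> {e \<in> edges. v \<in> e}"
  then obtain w where w: "e = {w, g w}" "v = w \<or> v = g w" by (auto simp: edges_def)
  then show "e \<in> {{v, g v}, {v, h v}}" by (elim disjE) (simp_all add: insert_commute)
next
  fix e assume "v \<in> W" "e \<in> {{v, g v}, {v, h v}}"
  moreover have "{v, g v} \<in> edges" if "v \<in> W" using that by (simp add: edges_def)
  moreover have "{v, h v} \<in> edges" if "v \<in> W" using that by (simp add: edges_altdef)
  ultimately show "e \<in> {e \<in> edges. v \<in> e}" by auto
qed

lemma degree: "v \<in> W \<Longrightarrow> card {e \<in> edges. v \<in> e} \<le> 2"
  by (simp add: edges_at card_insert_if)

lemma indecomposable: "indecomposable W edges"
  unfolding indecomposable_def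
proof (intro conjI allI impI)
  fix W1 F1 assume 1: "closed_part W edges W1 F1 \<and> (W1 \<noteq> {} \<or> F1 \<noteq> {})"
  then have sub: "W1 \<subseteq> W" "F1 \<subseteq> edges" and inc: "\<And>v e. v \<in> W \<Longrightarrow> e \<in> edges \<Longrightarrow> v \<in> e \<Longrightarrow> v \<in> W1 \<longleftrightarrow> e \<in> F1"
    by (auto simp: closed_part_def)
  have eF: "{v, g v} \<in> edges" if "v \<in> W" for v using that by (auto simp: edges_def)
  have "g v \<in> W1" if "v \<in> W1" for v
    using that sub inc[of v "{v, g v}"] inc[of "g v" "{v, g v}"] eF[of v] by auto
  moreover have "W1 \<noteq> {}"
  proof
    assume "W1 = {}"
    then obtain e where "e \<in> F1" using 1 by auto
    moreover from this obtain v where "v \<in> W" "v \<in> e" using sub by (auto simp: edges_def)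
    ultimately show False using inc[of v e] sub \<open>W1 = {}\<close> by auto
  qed
  ultimately show "W1 = W" using g_transitive[of W1] sub by auto
  then show "F1 = edges" using inc sub by (auto simp: edges_def)
qed (use W_nonempty in simp)

lemma connected: "connected_graph W edges"
  unfolding connected_graph_iff[OF edges_subset]
proof (intro conjI allI impI)
  fix S assume S: "S \<subseteq> W \<and> S \<noteq> {} \<and> (\<forall>x y. {x, y} \<in> edges \<longrightarrow> x \<in> S \<longrightarrow> y \<in> S)"
  have "g v \<in> S" if "v \<in> S" for v
    using S that by (auto simp: edges_def)
  then show "S = W" using S g_transitive[of S] by auto
qed (fact W_nonempty)

definition forward where "forward = (\<lambda>v\<in>W. {v, g v})"

lemma forward_matching: "forward \<in> matchings W edges"
proof -
  have "inj_on forward W"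
  proof (rule inj_onI)
    fix v w assume "v \<in> W" "w \<in> W" "forward v = forward w"
    then show "v = w" using g_g_neq[of w] by (auto simp: forward_def doubleton_eq_iff)
  qed
  then show ?thesis by (auto simp: matchings_def forward_def bij_betw_def edges_def)
qed

lemma set_det_forward:
  "set_det W (\<lambda>v. edge_row A (forward v) v) = 1 - (\<Prod>v\<in>W. gain A v (g v))"
proof -
  have "set_det W (\<lambda>v. edge_row A (forward v) v) =
      set_det W (\<lambda>v u. if u = v then 1 else if u = g v then - gain A v (g v) else 0)"
    by (rule set_det_cong) (auto simp: edge_row_def forward_def doubleton_eq_iff)
  also have "\<dots> = 1 - (\<Prod>v\<in>W. gain A v (g v))"
    using finite_W W_nonempty g_permutes g_sign g_transitive g_neq by (rule set_det_cyclic)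
  finally show ?thesis .
qed

text \<open>If \<open>v\<close> takes the edge to \<open>g v\<close>, then by injectivity
  \<open>g v\<close> must take its other edge, the one to \<open>g (g v)\<close>. Transitivity
  carries this around the whole cycle.\<close>

lemma matching_forward_propagates:
  assumes "f \<in> matchings W edges" "v \<in> W" "f v = {v, g v}"
  shows "f = forward"
proof -
  have inj: "inj_on f W" and fF: "\<And>v. v \<in> W \<Longrightarrow> f v \<in> {e \<in> edges. v \<in> e}" and ext: "f \<in> extensional W"
    using assms(1) by (auto simp: matchings_def bij_betw_def)
  let ?S = "{v \<in> W. f v = {v, g v}}"
  have "g w \<in> ?S" if w: "w \<in> ?S" for w
  proof -
    have "f (g w) \<noteq> f w" using inj_onD[OF inj, of "g w" w] w g_neq[of w] by auto
    moreover have "f (g w) \<in> {{g w, g (g w)}, {g w, w}}"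
      using fF[of "g w"] edges_at[of "g w"] w by simp
    ultimately show ?thesis using w by (auto simp: insert_commute)
  qed
  then have "?S = W" using assms by (intro g_transitive) auto
  then show ?thesis
    using ext by (intro extensionalityI[of _ W]) (auto simp: forward_def)
qed

end

context cyclic_permutation
begin

text \<open>The reversed orientation as a second instance: \<open>inv.forward\<close> is the other
  matching of the same edges.\<close>

interpretation inv: cyclic_permutation W h by (rule inverse)

lemma inv_edges: "inv.edges = edges"
  by (simp add: inv.edges_def edges_altdef)

lemma matchings_eq: "matchings W edges = {forward, inv.forward}"
proof -
  have "f = forward \<or> f = inv.forward" if f: "f \<in> matchings W edges" for f
  proof -
    obtain v where v: "v \<in> W" using W_nonempty by auto
    then have "f v \<in> {e \<in> edges. v \<in> e}" using f unfolding matchings_def bij_betw_def by blast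
    then have "f v \<in> {{v, g v}, {v, h v}}" by (simp only: edges_at[OF v])
    then have "f v = {v, g v} \<or> f v = {v, h v}" by simp
    then show ?thesis
      using matching_forward_propagates[OF f v] inv.matching_forward_propagates[of f v, unfolded inv_edges, OF f v]
      by blast
  qed
  then show ?thesis using forward_matching inv.forward_matching by (auto simp: inv_edges)
qed

lemma matching_sum_cyclic:
  assumes "asym A"
  shows "matching_sum A W edges = 2 - (\<Prod>v\<in>W. gain A v (g v)) - cnj (\<Prod>v\<in>W. gain A v (g v))"
proof -
  obtain v where v: "v \<in> W" using W_nonempty by auto
  have "h v \<noteq> g v" using g_g_neq[OF v] gh(1)[of v] by metis
  then have "forward v \<noteq> inv.forward v"
    using v by (auto simp: forward_def inv.forward_def doubleton_eq_iff)
  then have ne: "forward \<noteq> inv.forward" by metis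
  \<comment> \<open>Reindexing by \<open>g\<close> reads every edge from its other end, which
    conjugates each gain.\<close>
  have "(\<Prod>v\<in>W. gain A v (h v)) = (\<Prod>v\<in>W. gain A (g v) (h (g v)))"
    by (rule prod.reindex_bij_betw[OF permutes_imp_bij[OF g_permutes], symmetric])
  also have "\<dots> = cnj (\<Prod>v\<in>W. gain A v (g v))"
    by (simp add: cnj_gain[OF assms])
  finally show ?thesis
    unfolding matching_sum_def matchings_eq using ne
    by (simp add: set_det_forward inv.set_det_forward)
qed

end

lemma cyclic_permutation_cycle_of_list:
  assumes c: "3 \<le> length c" "distinct c"
  shows "cyclic_permutation (set c) (cycle_of_list c)"
    and "cyclic_permutation.edges (set c) (cycle_of_list c) = cycle_edges c"
proof -
  let ?g = "cycle_of_list c" and ?n = "length c"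
  have n: "0 < ?n" using c by linarith
  have g: "?g (c ! i) = c ! (Suc i mod ?n)" if "i < ?n" for i
    using c(2) that by (rule cycle_of_list_nth)
  have lt: "Suc i mod ?n < ?n" for i using n by simp
  have pow: "(?g ^^ k) (c ! i) = c ! ((i + k) mod ?n)" if "i < ?n" for i k
  proof (induction k)
    case (Suc k)
    then show ?case using g[of "(i + k) mod ?n"] n by (simp add: mod_Suc_eq)
  qed (use that in simp)
  show cyc: "cyclic_permutation (set c) ?g"
  proof
    show "?g permutes set c" by (rule cycle_permutes)
    have "c \<noteq> []" using n by auto
    then show "sign ?g = (- 1) ^ (card (set c) - 1)"
      using sign_cycle_of_list[OF c(2)] c(2) by (simp add: distinct_card)
  next
    fix S assume S: "S \<subseteq> set c" "S \<noteq> {}" "?g ` S \<subseteq> S"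
    then obtain i where i: "i < ?n" "c ! i \<in> S" by (metis all_not_in_conv in_set_conv_nth subsetD)
    have pS: "(?g ^^ k) (c ! i) \<in> S" for k
      by (induction k) (use i S in auto)
    have "c ! j \<in> S" if "j < ?n" for j
    proof -
      \<comment> \<open>Going once around from position \<open>i\<close> and on to \<open>j\<close>
        keeps the number of iterations a natural number.\<close>
      have "(i + (j + (?n - i))) mod ?n = j" using i(1) that by simp
      then show ?thesis using pS[of "j + (?n - i)"] pow[OF i(1), of "j + (?n - i)"] by simp
    qed
    then show "S = set c" using S(1) by (auto simp: in_set_conv_nth)
  next
    fix v assume "v \<in> set c"
    then obtain i where i: "i < ?n" "c ! i = v" by (auto simp: in_set_conv_nth)
    have 1: "Suc i mod ?n \<noteq> i" using c i by (simp add: mod_Suc)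
    have 2: "Suc (Suc i mod ?n) mod ?n \<noteq> i" using c i by (auto simp: mod_Suc)
    show "?g v \<noteq> v"
      using 1 i lt c(2) by (simp add: g nth_eq_iff_index_eq flip: i(2))
    show "?g (?g v) \<noteq> v"
      using 2 i lt c(2) by (simp add: g nth_eq_iff_index_eq flip: i(2))
  qed (use n in auto)
  have "set c = (!) c ` {..<?n}" by (auto simp: in_set_conv_nth)
  then show "cyclic_permutation.edges (set c) ?g = cycle_edges c"
    unfolding cyclic_permutation.edges_def[OF cyc] cycle_edges_altdef
    using g by (auto simp: image_image)
qed

section \<open>The gain of a cycle and its arc excess\<close>

definition cycle_gain :: "('v \<times> 'v) set \<Rightarrow> 'v list \<Rightarrow> complex" where
  "cycle_gain A c = (\<Prod>i<length c. gain A (c ! i) (c ! (Suc i mod length c)))"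

lemma matching_sum_cycle:
  assumes "asym A" and c: "3 \<le> length c" "distinct c"
  shows "matching_sum A (set c) (cycle_edges c) = 2 - cycle_gain A c - cnj (cycle_gain A c)"
proof -
  interpret cyclic_permutation "set c" "cycle_of_list c"
    using c by (rule cyclic_permutation_cycle_of_list)
  have "bij_betw ((!) c) {..<length c} (set c)"
    using c(2) by (simp add: bij_betw_nth)
  then have "(\<Prod>v\<in>set c. gain A v (cycle_of_list c v)) = cycle_gain A c"
    unfolding cycle_gain_def
    by (subst prod.reindex_bij_betw[symmetric]) (auto simp: cycle_of_list_nth[OF c(2)])
  then show ?thesis
    using matching_sum_cyclic[OF assms(1)] cyclic_permutation_cycle_of_list(2)[OF c] by simp
qed

lemma omega_power_6: "omega ^ 6 = 1"
proof -
  have "omega ^ 3 = -1"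
    by (simp add: power3_eq_cube omega_square algebra_simps)
  then have "(omega ^ 3) ^ 2 = 1" by simp
  then show ?thesis by (simp flip: power_mult)
qed

lemma cycle_gain_eq:
  assumes "asym A"
  shows "cycle_gain A c = omega ^ nat (arc_excess A c mod 6)"
proof -
  have gain: "gain A u v = (if (u, v) \<in> A then omega else 1) * (if (v, u) \<in> A then cnj omega else 1)" for u v
    using assms by (auto simp: gain_def dest: asymD)
  have "cycle_gain A c = omega ^ forward_arcs A c * cnj omega ^ backward_arcs A c"
    unfolding cycle_gain_def gain prod.distrib forward_arcs_def backward_arcs_def
    by (simp add: prod.If_cases Int_def)
  \<comment> \<open>The inverse of a sixth root of unity is its fifth power, so backward arcs also
    contribute natural exponents, with 5 congruent to -1 modulo 6.\<close>
  also have "cnj omega = omega ^ 5"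
  proof -
    have "omega ^ 5 * omega = cnj omega * omega"
      using omega_power_6 by (simp flip: power_Suc2)
    moreover have "omega \<noteq> 0" using omega_mult_cnj by force
    ultimately show ?thesis by (metis mult_right_cancel)
  qed
  also have "omega ^ forward_arcs A c * (omega ^ 5) ^ backward_arcs A c =
      omega ^ (forward_arcs A c + 5 * backward_arcs A c)"
    by (simp add: power_add flip: power_mult)
  also have "\<dots> = omega ^ ((forward_arcs A c + 5 * backward_arcs A c) mod 6)"
  proof -
    have "omega ^ (6 * q + r) = omega ^ r" for q r
      by (simp add: power_add power_mult omega_power_6)
    then show ?thesis by (metis mult_div_mod_eq)
  qed
  also have "(forward_arcs A c + 5 * backward_arcs A c) mod 6 = nat (arc_excess A c mod 6)"
  proof -
    have "int ((forward_arcs A c + 5 * backward_arcs A c) mod 6) = arc_excess A c mod 6"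
      unfolding arc_excess_def zmod_int by (simp add: mod_eq_dvd_iff)
    then show ?thesis by simp
  qed
  finally show ?thesis .
qed

lemma cycle_value:
  assumes "asym A"
  shows "2 - cycle_gain A c - cnj (cycle_gain A c) =
    (if arc_excess A c mod 6 = 0 then 0 else if arc_excess A c mod 6 \<in> {2, 4} then 3
     else if arc_excess A c mod 6 = 3 then 4 else 1)"
proof -
  have pow: "omega ^ 2 = omega - 1" "omega ^ 3 = -1" "omega ^ 4 = - omega" "omega ^ 5 = 1 - omega"
    by (simp_all add: eval_nat_numeral omega_square algebra_simps)
  have "arc_excess A c mod 6 \<in> {0, 1, 2, 3, 4, 5}"
    using pos_mod_bound[of 6 "arc_excess A c"] pos_mod_sign[of 6 "arc_excess A c"]
    unfolding insert_iff empty_iff by linarith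
  then show ?thesis
    unfolding cycle_gain_eq[OF assms] by (auto simp: pow cnj_omega simp del: complex_cnj_power)
qed

text \<open>The two cycle edges at a vertex already exhaust its degree, so no other edge of
  \<open>F\<close> meets the cycle.\<close>

lemma closed_part_traversal:
  assumes F: "finite F" and deg: "\<And>v. v \<in> W \<Longrightarrow> card {e \<in> F. v \<in> e} \<le> 2"
    and c: "is_traversal F c" "set c \<subseteq> W"
  shows "closed_part W F (set c) (cycle_edges c)"
  unfolding closed_part_def
proof (intro conjI ballI impI iffI)
  show sub: "cycle_edges c \<subseteq> F" using c by (simp add: is_traversal_def)
  fix v e assume ve: "v \<in> W" "e \<in> F" "v \<in> e"
  {
    assume "v \<in> set c"
    then obtain e1 e2 where e12: "e1 \<in> cycle_edges c" "e2 \<in> cycle_edges c" "e1 \<noteq> e2" "v \<in> e1" "v \<in> e2"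
      using two_cycle_edges_at_vertex c(1) unfolding is_traversal_def by metis
    have "{e1, e2} = {e \<in> F. v \<in> e}"
      using e12 sub F deg[OF ve(1)] by (intro card_seteq) auto
    then have "e \<in> {e1, e2}" using ve by simp
    then show "e \<in> cycle_edges c" using e12 by auto
  next
    assume "e \<in> cycle_edges c"
    then have "v \<in> \<Union>(cycle_edges c)" using ve(3) by (rule UnionI)
    then show "v \<in> set c" by (simp only: Union_cycle_edges)
  }
qed (fact c(2))

text \<open>The classes refer to some traversal, while the matching sum \<open>x\<close> refers to
  none. Each traversal has the whole cycle as its edge set and expresses \<open>x\<close> through
  its excess; as 0, 1, 3, 4 are distinct, \<open>x\<close> determines the class. So independence of
  the traversal comes for free.\<close>

lemma weight_cycle:
  assumes A: "asym A" and c: "3 \<le> length c" "distinct c"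
  shows "weight A (set c) (cycle_edges c) = matching_sum A (set c) (cycle_edges c)"
proof -
  interpret cyclic_permutation "set c" "cycle_of_list c"
    using c by (rule cyclic_permutation_cycle_of_list)
  have edges_eq: "edges = cycle_edges c" by (rule cyclic_permutation_cycle_of_list(2)[OF c])
  have trav: "is_traversal edges c" using c by (simp add: is_traversal_def edges_eq)
  have fin_edges: "finite edges" by (simp add: edges_eq cycle_edges_altdef)
  \<comment> \<open>The cycle of \<open>d\<close> is a nonempty closed part of an indecomposable
    structure, hence all of it.\<close>
  have same: "set d = set c \<and> cycle_edges d = edges" if d: "is_traversal edges d" for d
  proof -
    have "set d \<subseteq> set c"
      using d edges_subset Union_cycle_edges[of d] unfolding is_traversal_def by blast
    then have "closed_part (set c) edges (set d) (cycle_edges d)"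
      using closed_part_traversal[OF fin_edges degree d] by simp
    moreover have "set d \<noteq> {}" using d by (auto simp: is_traversal_def)
    ultimately show ?thesis using indecomposableD[OF indecomposable] by blast
  qed
  have cyc: "cycles edges = {edges}"
  proof (intro subset_antisym subsetI)
    fix Z assume "Z \<in> cycles edges"
    then obtain d where "Z = cycle_edges d" "is_traversal edges d" unfolding cycles_def by blast
    then show "Z \<in> {edges}" using same[of d] by simp
  next
    fix Z assume "Z \<in> {edges}"
    then show "Z \<in> cycles edges" using trav unfolding cycles_def edges_eq by blast
  qed
  have uni: "unicyclic (set c, edges)"
    using edges_subset connected cyc by (simp add: unicyclic_def)
  have "{e \<in> edges. e \<subseteq> set c} = edges" using edges_subset by auto
  then have "\<not> rootless_tree (set c, edges)"
    using cyc by (simp add: rootless_tree_def is_tree_def)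
  moreover define x where "x = matching_sum A (set c) edges"
  have val: "x = (if arc_excess A d mod 6 = 0 then 0 else if arc_excess A d mod 6 \<in> {2, 4} then 3
     else if arc_excess A d mod 6 = 3 then 4 else 1)" if d: "is_traversal edges d" for d
  proof -
    have "x = matching_sum A (set d) (cycle_edges d)" using same[OF d] by (simp add: x_def)
    also have "\<dots> = 2 - cycle_gain A d - cnj (cycle_gain A d)"
      using d by (intro matching_sum_cycle[OF A]) (auto simp: is_traversal_def)
    finally show ?thesis by (simp only: cycle_value[OF A])
  qed
  have excess: "arc_excess A d mod 6 \<in> {2, 4} \<longleftrightarrow> x = 3" "arc_excess A d mod 6 = 3 \<longleftrightarrow> x = 4"
    "arc_excess A d mod 6 = 0 \<longleftrightarrow> x = 0" if "is_traversal edges d" for d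
    using val[OF that] by (simp_all split: if_splits)
  have "in_Phi2 A (set c, edges) \<longleftrightarrow> x = 3" "in_Phi3 A (set c, edges) \<longleftrightarrow> x = 4" "in_Phi4 A (set c, edges) \<longleftrightarrow> x = 0"
    unfolding in_Phi2_def in_Phi3_def in_Phi4_def
    using trav by (auto simp only: prod.case excess cong: conj_cong)
  moreover have "x \<in> {0, 1, 3, 4}" using val[OF trav] by auto
  ultimately have "component_weight A (set c, edges) = x"
    using uni by (auto simp: component_weight_def)
  then show ?thesis
    using weight_indecomposable[OF indecomposable] by (simp add: x_def edges_eq)
qed

section \<open>The expansion of the determinant\<close>

text \<open>On a longest path every neighbour of the first vertex lies on the path, as otherwise the
  path could be extended. A second edge at that vertex closes an initial segment to a cycle.\<close>

lemma exists_traversal: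
  assumes W: "finite W" "W \<noteq> {}" and F: "\<And>e. e \<in> F \<Longrightarrow> e \<subseteq> W \<and> card e = 2"
    and deg: "\<And>v. v \<in> W \<Longrightarrow> 2 \<le> card {e \<in> F. v \<in> e}"
  obtains c where "is_traversal F c" "set c \<subseteq> W"
proof -
  define P where "P c \<longleftrightarrow> c \<noteq> [] \<and> distinct c \<and> set c \<subseteq> W \<and> (\<forall>i. Suc i < length c \<longrightarrow> {c ! i, c ! Suc i} \<in> F)"
    for c
  obtain w where "w \<in> W" using W by auto
  then have "P [w]" by (simp add: P_def)
  moreover have "length c \<le> card W" if "P c" for c
    using that W by (metis P_def card_mono distinct_card)
  ultimately obtain c where c: "P c" and longest: "\<And>d. P d \<Longrightarrow> length d \<le> length c"
    using ex_has_greatest_nat[of P "[w]" length "Suc (card W)"] by (metis le_imp_less_Suc)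
  have c': "distinct c" "set c \<subseteq> W" and path: "\<And>i. Suc i < length c \<Longrightarrow> {c ! i, c ! Suc i} \<in> F"
    and len: "0 < length c"
    using c by (auto simp: P_def)
  let ?x = "c ! 0"
  have x: "?x \<in> W" using c'(2) len by (meson nth_mem subsetD)
  have nb: "\<exists>j. 0 < j \<and> j < length c \<and> e = {?x, c ! j}" if e: "e \<in> F" "?x \<in> e" for e
  proof -
    have "card e = 2" using F e by blast
    then obtain a b where ab: "e = {a, b}" "a \<noteq> b" unfolding card_2_iff by blast
    define y where "y = (if a = ?x then b else a)"
    have y: "e = {?x, y}" "y \<noteq> ?x" using ab e(2) by (auto simp: y_def)
    have "y \<in> set c"
    proof (rule ccontr)
      assume "y \<notin> set c"
      have "y \<in> W" using F[OF e(1)] y by auto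
      have "P (y # c)"
        unfolding P_def
      proof (intro conjI allI impI)
        fix i assume "Suc i < length (y # c)"
        then show "{(y # c) ! i, (y # c) ! Suc i} \<in> F"
          using path y e(1) by (cases i) (auto simp: insert_commute)
      qed (use c' \<open>y \<notin> set c\<close> \<open>y \<in> W\<close> in auto)
      then show False using longest[of "y # c"] by simp
    qed
    then obtain j where "j < length c" "y = c ! j" by (auto simp: in_set_conv_nth)
    then show ?thesis using y by (metis neq0_conv)
  qed
  \<comment> \<open>For a path with one vertex \<open>c ! 1\<close> is unspecified; the singleton
    still has fewer elements than the degree of \<open>?x\<close>.\<close>
  have "\<not> {e \<in> F. ?x \<in> e} \<subseteq> {{?x, c ! 1}}"
  proof
    assume "{e \<in> F. ?x \<in> e} \<subseteq> {{?x, c ! 1}}"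
    then have "card {e \<in> F. ?x \<in> e} \<le> card {{?x, c ! 1}}" by (intro card_mono) auto
    then show False using deg[OF x] by simp
  qed
  then obtain e where e: "e \<in> F" "?x \<in> e" "e \<noteq> {?x, c ! 1}" by blast
  then obtain j where j: "0 < j" "j < length c" "e = {?x, c ! j}" using nb by blast
  \<comment> \<open>The edge is not the first one of the path, so the closed segment
    \<open>take (Suc j) c\<close> has at least three vertices.\<close>
  then have j2: "2 \<le> j" using e(3) by (cases "j = 1") auto
  let ?d = "take (Suc j) c"
  have lend: "length ?d = Suc j" using j by simp
  have "{?d ! i, ?d ! (Suc i mod length ?d)} \<in> F" if "i < length ?d" for i
  proof (cases "i = j")
    case True
    then show ?thesis using j e(1) unfolding lend by (simp add: insert_commute)
  next
    case False
    then have "i < j" using that lend by simp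
    then show ?thesis using path[of i] j(2) unfolding lend by simp
  qed
  then have "is_traversal F ?d"
    using j2 c' lend by (auto simp: is_traversal_def cycle_edges_def)
  moreover have "set ?d \<subseteq> W" using c'(2) set_take_subset by (rule_tac subset_trans)
  ultimately show thesis by (rule that)
qed

text \<open>Double counting of incidences: the degree sum is at least \<open>2 * card W\<close> and
  at most \<open>2 * card F\<close>. These are equal, so every single estimate is sharp.\<close>

lemma two_regular_of_min_degree:
  assumes fin: "finite W" "finite F" and card: "card W = card F" and two: "\<forall>e\<in>F. card e = 2"
    and deg: "\<And>v. v \<in> W \<Longrightarrow> 2 \<le> card {e \<in> F. v \<in> e}"
  shows "\<And>v. v \<in> W \<Longrightarrow> card {e \<in> F. v \<in> e} = 2" and "\<And>e. e \<in> F \<Longrightarrow> e \<subseteq> W"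
proof -
  have finite_e: "finite e" if "e \<in> F" for e using two that by (intro card_ge_0_finite) simp
  have "(\<Sum>v\<in>W. card {e \<in> F. v \<in> e}) = (\<Sum>e\<in>F. card (e \<inter> W))"
  proof -
    have "(\<Sum>v\<in>W. card {e \<in> F. v \<in> e}) = (\<Sum>v\<in>W. \<Sum>e\<in>F. if v \<in> e then 1 else 0)"
      using fin by (simp add: sum.If_cases Int_def)
    also have "\<dots> = (\<Sum>e\<in>F. \<Sum>v\<in>W. if v \<in> e then 1 else 0)" by (rule sum.swap)
    also have "\<dots> = (\<Sum>e\<in>F. card (e \<inter> W))"
      using fin by (simp add: sum.If_cases Int_def conj_commute)
    finally show ?thesis .
  qed
  moreover have le: "card (e \<inter> W) \<le> 2" if "e \<in> F" for e
    using card_mono[of e "e \<inter> W"] finite_e[OF that] two that by auto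
  ultimately have "(\<Sum>v\<in>W. card {e \<in> F. v \<in> e}) \<le> (\<Sum>v\<in>W. 2)"
    using sum_mono[of F "\<lambda>e. card (e \<inter> W)" "\<lambda>_. 2"] card by simp
  moreover have "(\<Sum>v\<in>W. 2) \<le> (\<Sum>v\<in>W. card {e \<in> F. v \<in> e})"
    using deg by (rule sum_mono)
  ultimately have eq: "(\<Sum>v\<in>W. card {e \<in> F. v \<in> e}) = (\<Sum>v\<in>W. 2)" by simp
  show "card {e \<in> F. v \<in> e} = 2" if "v \<in> W" for v
    using sum_mono_inv[OF eq[symmetric] deg that fin(1)] by simp
  have "(\<Sum>e\<in>F. card (e \<inter> W)) = (\<Sum>e\<in>F. 2)"
    using eq \<open>(\<Sum>v\<in>W. card {e \<in> F. v \<in> e}) = (\<Sum>e\<in>F. card (e \<inter> W))\<close> card by simp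
  then have "card (e \<inter> W) = 2" if "e \<in> F" for e
    using sum_mono_inv[OF _ le that fin(2)] by simp
  then show "e \<subseteq> W" if "e \<in> F" for e
    using card_subset_eq[of e "e \<inter> W"] finite_e[OF that] two that by auto
qed

text \<open>Peeling a leaf or a cycle removes as many edges as vertices, so the equality of
  cardinalities persists through the induction. Edges keep both endpoints as sets even after one has
  left \<open>W\<close>, which is how rootless trees arise.\<close>

lemma matching_sum_eq_weight:
  assumes A: "asym A" and "finite W" "finite F" "card W = card F" "\<forall>e\<in>F. card e = 2"
  shows "matching_sum A W F = weight A W F"
  using assms(2-)
proof (induction "card W" arbitrary: W F rule: less_induct)
  case less
  note fin = less.prems(1,2) and card = less.prems(3) and two = less.prems(4)
  show ?case
  proof (cases "W = {}")
    case True
    then have "F = {}" using fin card by simp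
    then show ?thesis using True by simp
  next
    case nonempty: False
    show ?thesis
    proof (cases "\<forall>v\<in>W. 2 \<le> card {e \<in> F. v \<in> e}")
      case True
      then have deg: "2 \<le> card {e \<in> F. v \<in> e}" if "v \<in> W" for v using that by blast
      note reg = two_regular_of_min_degree[OF fin card two deg]
      obtain c where c: "is_traversal F c" "set c \<subseteq> W"
        using exists_traversal[OF fin(1) nonempty _ deg] reg(2) two by blast
      then have c': "3 \<le> length c" "distinct c" and sub: "cycle_edges c \<subseteq> F"
        by (auto simp: is_traversal_def)
      have cl: "closed_part W F (set c) (cycle_edges c)"
        using c reg(1) by (intro closed_part_traversal fin) auto
      interpret cyclic_permutation "set c" "cycle_of_list c"
        using c' by (rule cyclic_permutation_cycle_of_list)
      \<comment> \<open>An orientation of the cycle is a bijection from its vertices to its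
        edges.\<close>
      have "card (cycle_edges c) = card (set c)"
        using forward_matching cyclic_permutation_cycle_of_list(2)[OF c']
        by (auto simp: matchings_def dest: bij_betw_same_card)
      then have card': "card (set c) = card (cycle_edges c)" ..
      have "set c \<noteq> {}" using c' by auto
      then have "0 < card (set c)" "0 < card W"
        using fin(1) nonempty by (simp_all only: card_gt_0_iff) auto
      then have lt: "card (W - set c) < card W"
        using c(2) by (simp add: card_Diff_subset)
      have card'': "card (W - set c) = card (F - cycle_edges c)"
        using fin c(2) sub card card' by (simp add: card_Diff_subset finite_subset)
      have "matching_sum A W F =
          matching_sum A (set c) (cycle_edges c) * matching_sum A (W - set c) (F - cycle_edges c)"
        using cl by (intro matching_sum_split fin c(2) sub card') (auto simp: closed_part_def)
      also have "matching_sum A (W - set c) (F - cycle_edges c) = weight A (W - set c) (F - cycle_edges c)"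
        using fin two by (intro less.hyps[OF lt _ _ card'']) auto
      also have "matching_sum A (set c) (cycle_edges c) = weight A (set c) (cycle_edges c)"
        using weight_cycle[OF A c'] ..
      also have "weight A (set c) (cycle_edges c) * weight A (W - set c) (F - cycle_edges c) = weight A W F"
        using weight_split[OF fin cl] ..
      finally show ?thesis .
    next
      case False
      then obtain v where v: "v \<in> W" "card {e \<in> F. v \<in> e} < 2" by auto
      then consider "card {e \<in> F. v \<in> e} = 0" | "card {e \<in> F. v \<in> e} = 1" by linarith
      then show ?thesis
      proof cases
        case 1
        then have "{e \<in> F. v \<in> e} = {}" using fin by simp
        then show ?thesis
          using matching_sum_isolated_vertex weight_isolated_vertex fin v(1) by metis
      next
        case 2
        then obtain e where e: "{e \<in> F. v \<in> e} = {e}" by (meson card_1_singletonE)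
        then have "e \<in> F" by auto
        have "matching_sum A (W - {v}) (F - {e}) = weight A (W - {v}) (F - {e})"
        proof (rule less.hyps)
          show "card (W - {v}) < card W" using v(1) fin by (intro psubset_card_mono) auto
          show "card (W - {v}) = card (F - {e})" using v(1) \<open>e \<in> F\<close> card by simp
        qed (use fin two in auto)
        then show ?thesis
          using matching_sum_peel_leaf[OF fin v(1) e] weight_peel_leaf[OF fin two v(1) e] by simp
      qed
    qed
  qed
qed

section \<open>Row expansion of the Laplacian\<close>

lemma set_det_edge_rows_not_inj:
  assumes A: "asym A" and W: "finite W" and two: "\<And>v. v \<in> W \<Longrightarrow> v \<in> f v \<and> card (f v) = 2"
    and inj: "\<not> inj_on f W"
  shows "set_det W (\<lambda>v. edge_row A (f v) v) = 0"
proof -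
  obtain u v where uv: "u \<in> W" "v \<in> W" "u \<noteq> v" "f u = f v"
    using inj by (auto simp: inj_on_def)
  have "{u, v} = f v"
    using two[OF uv(1)] two[OF uv(2)] uv(3,4) by (intro card_seteq) (auto intro: card_ge_0_finite)
  then have fv: "f u = {u, v}" "f v = {u, v}" using uv by simp_all
  show ?thesis
  proof (rule set_det_proportional_rows[OF W uv(1-3)])
    fix w assume "w \<in> W"
    \<comment> \<open>Both rows live on the columns \<open>u\<close> and \<open>v\<close> of the
      common edge; they are proportional because the gains in the two directions are mutually
      inverse.\<close>
    show "edge_row A (f u) u w = - gain A u v * edge_row A (f v) v w"
      using uv(3) gain_mult_gain[OF A, of u v]
      by (auto simp: edge_row_def fv doubleton_eq_iff)
  qed
qed

lemma set_det_edge_rows_sum: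
  assumes A: "asym A" and E: "finite E" "\<And>e. e \<in> E \<Longrightarrow> card e = 2" and W: "finite W"
  shows "set_det W (\<lambda>v u. \<Sum>e\<in>{e \<in> E. v \<in> e}. edge_row A e v u) =
    (\<Sum>F | F \<subseteq> E \<and> card F = card W. matching_sum A W F)"
proof -
  let ?B = "\<lambda>v. {e \<in> E. v \<in> e}"
  let ?D = "\<lambda>f. set_det W (\<lambda>v. edge_row A (f v) v)"
  let ?I = "{f \<in> PiE W ?B. inj_on f W}"
  let ?S = "{F. F \<subseteq> E \<and> card F = card W}"
  have finP: "finite (PiE W ?B)" using W E by (intro finite_PiE) auto
  have finS: "finite ?S" using E by (intro finite_subset[of ?S "Pow E"]) auto
  have "set_det W (\<lambda>v u. \<Sum>e\<in>?B v. edge_row A e v u) = (\<Sum>f\<in>PiE W ?B. ?D f)"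
    using W E by (intro set_det_sum_rows) auto
  also have "\<dots> = (\<Sum>f\<in>?I. ?D f)"
  proof (rule sum.mono_neutral_right[OF finP])
    show "\<forall>f\<in>PiE W ?B - ?I. ?D f = 0"
      using E(2) by (auto intro!: set_det_edge_rows_not_inj[OF A W] dest: PiE_mem)
  qed auto
  also have "\<dots> = (\<Sum>F\<in>?S. \<Sum>f\<in>{f \<in> ?I. f ` W = F}. ?D f)"
    using finP finS
    by (intro sum.group[symmetric]) (auto simp: card_image dest: PiE_mem)
  also have "\<dots> = (\<Sum>F\<in>?S. matching_sum A W F)"
    unfolding matching_sum_def
  proof (intro sum.cong refl)
    fix F assume "F \<in> ?S"
    then show "{f \<in> ?I. f ` W = F} = matchings W F"
      by (auto simp: matchings_def bij_betw_def PiE_iff)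
  qed
  finally show ?thesis .
qed

text \<open>On the diagonal each incident edge contributes 1, which gives the degree; off the
  diagonal only the edge joining the two vertices can contribute.\<close>

lemma L_mat_eq:
  assumes G: "mixed_graph V E A" and vs: "distinct vs" "set vs = V"
  shows "L_mat vs E A = mat (length vs) (length vs)
    (\<lambda>(i, j). \<Sum>e\<in>{e \<in> E. vs ! i \<in> e}. edge_row A e (vs ! i) (vs ! j))"
proof (rule eq_matI)
  interpret mixed_graph V E A by (rule G)
  have finE: "finite E"
    using simple finite_V by (intro finite_subset[of E "Pow V"]) auto
  fix i j
  assume "i < dim_row (mat (length vs) (length vs)
      (\<lambda>(i, j). \<Sum>e\<in>{e \<in> E. vs ! i \<in> e}. edge_row A e (vs ! i) (vs ! j)))"
    and "j < dim_col (mat (length vs) (length vs)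
      (\<lambda>(i, j). \<Sum>e\<in>{e \<in> E. vs ! i \<in> e}. edge_row A e (vs ! i) (vs ! j)))"
  then have ij: "i < length vs" "j < length vs" by simp_all
  let ?v = "vs ! i" and ?u = "vs ! j"
  have "(\<Sum>e\<in>{e \<in> E. ?v \<in> e}. edge_row A e ?v ?u) = L_mat vs E A $$ (i, j)"
  proof (cases "i = j")
    case True
    \<comment> \<open>A loop would be a one-element edge; its absence makes the diagonal of
      \<open>N_mat\<close> zero.\<close>
    have "{?v, ?v} \<notin> E" using simple[of "{?v}"] by auto
    then show ?thesis
      using ij True by (simp add: edge_row_def L_mat_def D_mat_def N_mat_def)
  next
    case False
    then have ne: "?u \<noteq> ?v" using ij vs by (simp add: nth_eq_iff_index_eq)
    have "(\<Sum>e\<in>{e \<in> E. ?v \<in> e}. edge_row A e ?v ?u) =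
        (\<Sum>e\<in>{e \<in> E. ?v \<in> e}. if e = {?v, ?u} then - gain A ?v ?u else 0)"
      using ne by (simp add: edge_row_def)
    also have "\<dots> = (if {?v, ?u} \<in> E then - gain A ?v ?u else 0)"
      using finE by (simp add: sum.delta)
    also have "\<dots> = L_mat vs E A $$ (i, j)"
      using ij False by (simp add: gain_def L_mat_def D_mat_def N_mat_def)
    finally show ?thesis .
  qed
  then show "L_mat vs E A $$ (i, j) = mat (length vs) (length vs)
      (\<lambda>(i, j). \<Sum>e\<in>{e \<in> E. vs ! i \<in> e}. edge_row A e (vs ! i) (vs ! j)) $$ (i, j)"
    using ij by simp
qed (simp_all add: L_mat_def N_mat_def)

theorem theorem2p7:
  fixes V V1 :: "'v set" and E :: "'v set set" and A :: "('v \<times> 'v) set" and vs :: "'v list"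
  assumes "mixed_graph V E A"
    and "distinct vs" and "set vs = V"
    and "V1 \<subseteq> V" and "V1 \<noteq> {}"
  shows "det (principal_submatrix (L_mat vs E A) vs V1) =
    (\<Sum>E1 \<in> {E1. E1 \<subseteq> E \<and> card E1 = card V1 \<and> type_I A V1 E1}.
       3 ^ gamma1 A V1 E1 * 4 ^ gamma2 A V1 E1)"
proof -
  interpret mixed_graph V E A by (rule assms(1))
  have A: "asym A" using arc_asym by (auto intro: asymI)
  have finE: "finite E"
    using simple finite_V by (intro finite_subset[of E "Pow V"]) auto
  have fin1: "finite V1" using assms(4) finite_V by (rule finite_subset)
  let ?S = "{E1. E1 \<subseteq> E \<and> card E1 = card V1}"
  have finS: "finite ?S" using finE by (intro finite_subset[of ?S "Pow E"]) auto
  have "det (principal_submatrix (L_mat vs E A) vs V1) =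
      set_det V1 (\<lambda>v u. \<Sum>e\<in>{e \<in> E. v \<in> e}. edge_row A e v u)"
    using assms by (intro det_principal_submatrix L_mat_eq) auto
  also have "\<dots> = (\<Sum>E1\<in>?S. matching_sum A V1 E1)"
    using simple by (intro set_det_edge_rows_sum A finE fin1) auto
  also have "\<dots> = (\<Sum>E1\<in>?S. if type_I A V1 E1 then 3 ^ gamma1 A V1 E1 * 4 ^ gamma2 A V1 E1 else 0)"
  proof (rule sum.cong[OF refl])
    fix E1 assume E1: "E1 \<in> ?S"
    then have "finite E1" using finE by (auto intro: finite_subset)
    moreover have "\<forall>e\<in>E1. card e = 2" using E1 simple by auto
    ultimately show "matching_sum A V1 E1 =
        (if type_I A V1 E1 then 3 ^ gamma1 A V1 E1 * 4 ^ gamma2 A V1 E1 else 0)"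
      using E1 matching_sum_eq_weight[OF A fin1] weight_eq_type_I[OF fin1] by simp
  qed
  also have "\<dots> = (\<Sum>E1\<in>{E1 \<in> ?S. type_I A V1 E1}. 3 ^ gamma1 A V1 E1 * 4 ^ gamma2 A V1 E1)"
    by (rule sum.inter_filter[OF finS, symmetric])
  also have "{E1 \<in> ?S. type_I A V1 E1} = {E1. E1 \<subseteq> E \<and> card E1 = card V1 \<and> type_I A V1 E1}"
    by auto
  finally show ?thesis .
qed

end
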